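(* Let $T$ be a piecewise linear expanding map (with finitely many branches) whose essential branch number is $r_T=2$. Then the number of Lyapunov inflections of $T$ is less than or equal to $2$.
   Context: An $n$-branch piecewise linear expanding map is a map $T: X=\bigcup_{i=1}^n X_i\to[0,1]$, where $X_1,\dots,X_n\subset[0,1]$ are closed intervals with pairwise disjoint interiors, each $T|_{X_i}$ is affine and maps $X_i$ onto $[0,1]$, and $|T'|=x_i:=|X_i|^{-1}>1$ on $X_i$ (the numbers $x_i$ are called the slopes; ambiguities at common endpoints are irrelevant). Indices are arranged so that $1<x_1\le x_2\le\cdots\le x_n$; slopes may coincide. The essential branch number $r_T=\#\{x_i: 1\le i\le n\}$ is the number of distinct slopes. The repeller is $\Lambda=\bigcap_{k\ge 0}T^{-k}(X)$. The Lyapunov exponent at $x\in\Lambda$ is $\lambda(x)=\lim_{m\to\infty}\frac1m\log|(T^m)'(x)|$ when the limit exists. The Lyapunov spectrum is $L(\alpha)=\dim_H\{x\in\Lambda:\lambda(x)=\alpha\}$ (Hausdorff dimension), defined for those $\alpha$ with nonempty level set; its domain is $[\log x_1,\log x_n]$. A Lyapunov inflection of $T$ is a point $\alpha\in(\log x_1,\log x_n)$ with $L''(\alpha)=0$. If the slopes are not all equal, put $F(t)=\sum_{i=1}^n x_i^t$. Then $\alpha(t)=F'(t)/F(t)$ is an increasing bijection from $\mathbb{R}$ onto $(\log x_1,\log x_n)$, and $L(\alpha(t))=\frac{F(t)\log F(t)}{F'(t)}-t$. *)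

theory Defs
  imports "HOL-Analysis.Analysis"
begin

section \<open>Hausdorff dimension of sets of reals\<close>

text \<open>
  Only used for \<open>s > 0\<close>, where \<open>0 powr s = 0\<close> makes empty and one-point sets contribute nothing.
  Boundedness is required explicitly because \<^const>\<open>diameter\<close> is unspecified on unbounded sets.
\<close>

definition hausdorff_measure_delta :: "real \<Rightarrow> real \<Rightarrow> real set \<Rightarrow> ennreal" where
  "hausdorff_measure_delta s \<delta> A =
     (INF U \<in> {U :: nat \<Rightarrow> real set. A \<subseteq> (\<Union>i. U i) \<and> (\<forall>i. bounded (U i) \<and> diameter (U i) \<le> \<delta>)}.
        (\<Sum>i. ennreal (diameter (U i) powr s)))"

definition hausdorff_measure :: "real \<Rightarrow> real set \<Rightarrow> ennreal" where
  "hausdorff_measure s A = (SUP \<delta> \<in> {0<..}. hausdorff_measure_delta s \<delta> A)"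

text \<open>
  The infimum is over a nonempty set, as every set of reals has
  \<open>s\<close>-dimensional Hausdorff measure zero for all \<open>s > 1\<close>.
\<close>

definition hausdorff_dim :: "real set \<Rightarrow> real" where
  "hausdorff_dim A = Inf {s. s > 0 \<and> hausdorff_measure s A = 0}"


section \<open>Piecewise linear expanding maps\<close>

text \<open>
  The branch intervals are \<open>X\<^sub>i = {l i..r i}\<close> for \<open>i \<in> {1..n}\<close>. The map \<open>T\<close> is a total function, but
  its values outside \<open>\<Union>X\<^sub>i\<close> play no role.
\<close>

definition pl_slope :: "(nat \<Rightarrow> real) \<Rightarrow> (nat \<Rightarrow> real) \<Rightarrow> nat \<Rightarrow> real" where
  "pl_slope l r i = 1 / (r i - l i)"

definition pl_domain :: "nat \<Rightarrow> (nat \<Rightarrow> real) \<Rightarrow> (nat \<Rightarrow> real) \<Rightarrow> real set" where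
  "pl_domain n l r = (\<Union>i\<in>{1..n}. {l i..r i})"

text \<open>
  Adjacent branch intervals may share an endpoint, where the two affine branches need not agree;
  there \<open>T\<close> may take the value of either one. At all other points of \<open>X\<^sub>i\<close> the last condition
  forces \<open>T\<close> to coincide with the branch \<open>f i\<close>. The condition on images gives \<open>f i\<close> the
  derivative \<open>\<plusminus> pl_slope l r i\<close>.
\<close>

definition pl_expanding_map ::
  "nat \<Rightarrow> (nat \<Rightarrow> real) \<Rightarrow> (nat \<Rightarrow> real) \<Rightarrow> (real \<Rightarrow> real) \<Rightarrow> bool" where
  "pl_expanding_map n l r T \<longleftrightarrow>
     1 \<le> n \<and>
     (\<forall>i\<in>{1..n}. {l i..r i} \<subseteq> {0..1} \<and> 1 < pl_slope l r i) \<and>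
     disjoint_family_on (\<lambda>i. interior {l i..r i}) {1..n} \<and>
     mono_on {1..n} (pl_slope l r) \<and>
     (\<exists>f :: nat \<Rightarrow> real \<Rightarrow> real.
        (\<forall>i\<in>{1..n}. (\<exists>c d. \<forall>x. f i x = c * x + d) \<and> f i ` {l i..r i} = {0..1}) \<and>
        (\<forall>x\<in>pl_domain n l r. \<exists>i\<in>{1..n}. x \<in> {l i..r i} \<and> T x = f i x))"

definition essential_branch_number :: "nat \<Rightarrow> (nat \<Rightarrow> real) \<Rightarrow> (nat \<Rightarrow> real) \<Rightarrow> nat" where
  "essential_branch_number n l r = card (pl_slope l r ` {1..n})"

definition repeller ::
  "nat \<Rightarrow> (nat \<Rightarrow> real) \<Rightarrow> (nat \<Rightarrow> real) \<Rightarrow> (real \<Rightarrow> real) \<Rightarrow> real set" where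
  "repeller n l r T = (\<Inter>k. (T ^^ k) -` pl_domain n l r)"


section \<open>Lyapunov spectrum\<close>

definition iterate_domain ::
  "nat \<Rightarrow> (nat \<Rightarrow> real) \<Rightarrow> (nat \<Rightarrow> real) \<Rightarrow> (real \<Rightarrow> real) \<Rightarrow> nat \<Rightarrow> real set" where
  "iterate_domain n l r T m = (\<Inter>k<m. (T ^^ k) -` pl_domain n l r)"

text \<open>
  Derivatives are taken within the domain of definition of \<open>T ^^ m\<close>, hence are one-sided at the
  outer endpoints of the branches. The exponent is undefined at the countably many points whose
  orbit meets a common endpoint of two branches in such a way that some \<open>T ^^ m\<close> is not
  differentiable.
\<close>

definition has_lyapunov_exponent ::
  "nat \<Rightarrow> (nat \<Rightarrow> real) \<Rightarrow> (nat \<Rightarrow> real) \<Rightarrow> (real \<Rightarrow> real) \<Rightarrow> real \<Rightarrow> real \<Rightarrow> bool" where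
  "has_lyapunov_exponent n l r T x \<alpha> \<longleftrightarrow>
     (\<exists>D :: nat \<Rightarrow> real.
        (\<forall>m. ((T ^^ m) has_real_derivative D m) (at x within iterate_domain n l r T m)) \<and>
        (\<lambda>m. 1 / real m * ln \<bar>D m\<bar>) \<longlonglongrightarrow> \<alpha>)"

definition lyapunov_spectrum ::
  "nat \<Rightarrow> (nat \<Rightarrow> real) \<Rightarrow> (nat \<Rightarrow> real) \<Rightarrow> (real \<Rightarrow> real) \<Rightarrow> real \<Rightarrow> real" where
  "lyapunov_spectrum n l r T \<alpha> =
     hausdorff_dim {x \<in> repeller n l r T. has_lyapunov_exponent n l r T x \<alpha>}"

definition lyapunov_inflections ::
  "nat \<Rightarrow> (nat \<Rightarrow> real) \<Rightarrow> (nat \<Rightarrow> real) \<Rightarrow> (real \<Rightarrow> real) \<Rightarrow> real set" where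
  "lyapunov_inflections n l r T =
     {\<alpha> \<in> {ln (pl_slope l r 1)<..<ln (pl_slope l r n)}.
        \<exists>L'. (\<forall>\<^sub>F \<beta> in nhds \<alpha>. (lyapunov_spectrum n l r T has_real_derivative L' \<beta>) (at \<beta>)) \<and>
             (L' has_real_derivative 0) (at \<alpha>)}"

end

theory Submission
  imports Defs "HOL-Real_Asymp.Real_Asymp"
begin

text \<open>
  For a level \<open>\<alpha>\<close> let \<open>\<mu>\<close> be the Bernoulli measure of maximal entropy among those with Lyapunov exponent
  \<open>\<alpha>\<close>. Its probabilities have the form \<open>exp (- (g + c (ln x\<^sub>i - \<alpha>)))\<close>, so that a word whose log-slope is
  close to \<open>\<alpha>\<close> times its length \<open>m\<close> has mass close to \<open>exp (- g m)\<close> and its cylinder has length close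
  to \<open>exp (- \<alpha> m)\<close>. Covering the level set by such cylinders gives the upper bound \<open>g / \<alpha>\<close> for its
  dimension. For the lower bound, Chebyshev's inequality provides enough such words to find a map from
  \<open>[0, 1)\<close> into the level set whose inverse is Hoelder of any exponent below \<open>g / \<alpha>\<close>.

  With two slopes, whose logarithms are \<open>A < B\<close>, the entropy \<open>g\<close> is a function of the frequency
  \<open>\<theta> = (\<alpha> - A) / (B - A)\<close> of the larger slope, namely \<open>- \<theta> ln \<theta> - (1 - \<theta>) ln (1 - \<theta>)\<close> up to an affine
  function. Inflections of \<open>L = g / \<alpha>\<close> are the zeros of \<open>K = \<alpha>\<^sup>2 g'' - 2 \<alpha> g' + 2 g\<close>, and
  \<open>K' = \<alpha>\<^sup>2 g'''\<close> vanishes only for \<open>\<theta> = 1 / 2\<close>. By Rolle's theorem \<open>K\<close> has at most two zeros.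
\<close>

section \<open>Zeros of the second derivative\<close>

text \<open>Otherwise some three-element subset exists, also when the set is infinite; listed in
  increasing order it is the forbidden chain.\<close>

lemma finite_card_le_two:
  fixes A :: "'a::linorder set"
  assumes "\<And>x y z. \<lbrakk>x \<in> A; y \<in> A; z \<in> A; x < y; y < z\<rbrakk> \<Longrightarrow> False"
  shows "finite A \<and> card A \<le> 2"
proof (rule ccontr)
  assume neg: "\<not> (finite A \<and> card A \<le> 2)"
  obtain B where B: "B \<subseteq> A" "card B = 3" "finite B"
  proof (cases "finite A")
    case True
    then show ?thesis
      using neg that obtain_subset_with_card_n[of 3 A] by force
  next
    case False
    then show ?thesis
      using that infinite_arbitrarily_large[of A 3] by blast
  qed
  define xs where "xs = sorted_list_of_set B"
  have xs: "set xs = B" "length xs = 3" "sorted_wrt (<) xs"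
    unfolding xs_def using B by auto
  have "xs ! 0 < xs ! 1" "xs ! 1 < xs ! 2"
    using xs by (auto simp: sorted_wrt_nth_less)
  moreover have "xs ! 0 \<in> A" "xs ! 1 \<in> A" "xs ! 2 \<in> A"
    using xs B(1) nth_mem[of _ xs] by auto
  ultimately show False
    using assms by blast
qed

text \<open>By Rolle's theorem, three zeros would enclose two distinct critical points.\<close>

lemma card_zeros_le_two:
  fixes f f' :: "real \<Rightarrow> real"
  assumes der: "\<And>u. u \<in> {a<..<b} \<Longrightarrow> (f has_real_derivative f' u) (at u)"
    and crit: "\<And>u. \<lbrakk>u \<in> {a<..<b}; f' u = 0\<rbrakk> \<Longrightarrow> u = m"
  shows "finite {u \<in> {a<..<b}. f u = 0} \<and> card {u \<in> {a<..<b}. f u = 0} \<le> 2"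
proof (rule finite_card_le_two)
  have rolle: "\<exists>u\<in>{x<..<y}. f' u = 0"
    if "x \<in> {a<..<b}" "y \<in> {a<..<b}" "f x = 0" "f y = 0" "x < y" for x y
  proof -
    have "\<exists>z>x. z < y \<and> f y - f x = (y - x) * f' z"
      by (rule MVT2[OF \<open>x < y\<close>]) (use that der in auto)
    with that show ?thesis by auto
  qed
  fix x y z
  assume "x \<in> {u \<in> {a<..<b}. f u = 0}" "y \<in> {u \<in> {a<..<b}. f u = 0}"
    "z \<in> {u \<in> {a<..<b}. f u = 0}" "x < y" "y < z"
  moreover from this obtain u v where "u \<in> {x<..<y}" "f' u = 0" "v \<in> {y<..<z}" "f' v = 0"
    using rolle[of x y] rolle[of y z] by auto
  ultimately show False
    using crit[of u] crit[of v] by auto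
qed

text \<open>Entropy of the distribution that splits mass \<theta> evenly among \<open>q\<close>
  branches of log-slope \<open>B\<close> and the rest evenly among \<open>p\<close> branches of
  log-slope \<open>A\<close>; the mean log-slope \<open>u\<close> determines \<theta>.\<close>

definition two_slope_entropy :: "real \<Rightarrow> real \<Rightarrow> real \<Rightarrow> real \<Rightarrow> real \<Rightarrow> real" where
  "two_slope_entropy A B p q u =
     (let \<theta> = (u - A) / (B - A)
      in \<theta> * (ln q - ln \<theta>) + (1 - \<theta>) * (ln p - ln (1 - \<theta>)))"

lemma two_slope_inflections:
  fixes L :: "real \<Rightarrow> real"
  assumes AB: "0 < A" "A < B" and pq: "0 < p" "0 < q"
    and L: "\<And>u. u \<in> {A<..<B} \<Longrightarrow> L u = two_slope_entropy A B p q u / u"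
  defines "S \<equiv> {\<alpha> \<in> {A<..<B}. \<exists>L'. (\<forall>\<^sub>F \<beta> in nhds \<alpha>. (L has_real_derivative L' \<beta>) (at \<beta>)) \<and>
             (L' has_real_derivative 0) (at \<alpha>)}"
  shows "finite S \<and> card S \<le> 2"
proof -
  define D where "D = B - A"
  define \<theta> where "\<theta> = (\<lambda>u. (u - A) / D)"
  define \<sigma> where "\<sigma> = (\<lambda>u. 1 - \<theta> u)"
  define g0 where "g0 = (\<lambda>u. \<theta> u * (ln q - ln (\<theta> u)) + \<sigma> u * (ln p - ln (\<sigma> u)))"
  \<comment> \<open>\<open>g1\<close>, \<open>g2\<close> and \<open>g3\<close> are the successive
    derivatives of the entropy \<open>g0\<close>.\<close>
  define g1 where "g1 = (\<lambda>u. (ln q - ln (\<theta> u) - ln p + ln (\<sigma> u)) / D)"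
  define g2 where "g2 = (\<lambda>u. - (1 / \<theta> u + 1 / \<sigma> u) / D^2)"
  define g3 where "g3 = (\<lambda>u. (1 / \<theta> u ^ 2 - 1 / \<sigma> u ^ 2) / D^3)"
  define K where "K = (\<lambda>u. u^2 * g2 u - 2 * u * g1 u + 2 * g0 u)"
  have D: "D > 0" using AB by (simp add: D_def)
  have \<theta>01: "0 < \<theta> u" "0 < \<sigma> u" if "u \<in> {A<..<B}" for u
    using that D by (auto simp: \<theta>_def \<sigma>_def D_def field_simps)
  have d\<theta>: "(\<theta> has_real_derivative 1 / D) (at u)" for u
    unfolding \<theta>_def using D by (auto intro!: derivative_eq_intros)
  have d\<sigma>: "(\<sigma> has_real_derivative - 1 / D) (at u)" for u
    unfolding \<sigma>_def using D by (auto intro!: derivative_eq_intros d\<theta>)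
  have d0: "(g0 has_real_derivative g1 u) (at u)" if "u \<in> {A<..<B}" for u
    unfolding g0_def g1_def using \<theta>01[OF that] D
    by (auto intro!: derivative_eq_intros d\<theta> d\<sigma> simp: field_simps)
  have d1: "(g1 has_real_derivative g2 u) (at u)" if "u \<in> {A<..<B}" for u
    unfolding g1_def g2_def using \<theta>01[OF that] D
    by (auto intro!: derivative_eq_intros d\<theta> d\<sigma> simp: field_simps power2_eq_square)
  have d2: "(g2 has_real_derivative g3 u) (at u)" if "u \<in> {A<..<B}" for u
    unfolding g2_def g3_def using \<theta>01[OF that] D
    by (auto intro!: derivative_eq_intros d\<theta> d\<sigma> simp: field_simps power2_eq_square power3_eq_cube)
  \<comment> \<open>\<open>K\<close> is \<open>u\<^sup>3\<close> times the second derivative of \<open>g0 u / u\<close>; in its derivative everything but \<open>g3\<close> cancels\<close>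
  have dK: "(K has_real_derivative u^2 * g3 u) (at u)" if "u \<in> {A<..<B}" for u
    unfolding K_def
    by (auto intro!: derivative_eq_intros d0[OF that] d1[OF that] d2[OF that] simp: algebra_simps)
  have crit: "u = (A + B) / 2" if "u \<in> {A<..<B}" "u^2 * g3 u = 0" for u
  proof -
    have "1 / \<theta> u ^ 2 = 1 / \<sigma> u ^ 2"
      using that AB D by (auto simp: g3_def)
    then have "\<theta> u ^ 2 = \<sigma> u ^ 2"
      using \<theta>01[OF that(1)] by (simp add: field_simps)
    then have "\<theta> u = \<sigma> u"
      using \<theta>01[OF that(1)] by simp
    then have "\<theta> u = 1 / 2"
      by (simp add: \<sigma>_def)
    then show ?thesis
      using D by (simp add: \<theta>_def D_def field_simps)
  qed
  have "S \<subseteq> {u \<in> {A<..<B}. K u = 0}"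
  proof
    fix u assume "u \<in> S"
    then obtain L' where u: "u \<in> {A<..<B}"
      and ev: "\<forall>\<^sub>F \<beta> in nhds u. (L has_real_derivative L' \<beta>) (at \<beta>)"
      and L'': "(L' has_real_derivative 0) (at u)"
      unfolding S_def by auto
    have evI: "\<forall>\<^sub>F \<beta> in nhds u. \<beta> \<in> {A<..<B}"
      using u by (intro eventually_nhds_in_open) auto
    \<comment> \<open>An inflection only provides some \<open>L'\<close>; uniqueness of derivatives
      will identify it near \<open>u\<close> with this explicit formula, whose derivative is
      \<open>K u / u^3\<close>.\<close>
    have dL: "(L has_real_derivative (g1 \<beta> / \<beta> - g0 \<beta> / \<beta>^2)) (at \<beta>)" if b: "\<beta> \<in> {A<..<B}" for \<beta>
    proof -
      have "((\<lambda>v. g0 v / v) has_real_derivative (g1 \<beta> / \<beta> - g0 \<beta> / \<beta>^2)) (at \<beta>)"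
        using b AB by (auto intro!: derivative_eq_intros d0 simp: field_simps power2_eq_square)
      moreover have "\<forall>\<^sub>F v in nhds \<beta>. L v = g0 v / v"
      proof (rule eventually_mono)
        show "\<forall>\<^sub>F v in nhds \<beta>. v \<in> {A<..<B}"
          using b by (intro eventually_nhds_in_open) auto
        show "L v = g0 v / v" if "v \<in> {A<..<B}" for v
          using L[OF that] by (simp add: two_slope_entropy_def g0_def \<sigma>_def \<theta>_def D_def Let_def)
      qed
      ultimately show ?thesis
        using DERIV_cong_ev[OF refl, of L "\<lambda>v. g0 v / v" \<beta>] by simp
    qed
    have "\<forall>\<^sub>F \<beta> in nhds u. L' \<beta> = g1 \<beta> / \<beta> - g0 \<beta> / \<beta>^2"
      using ev evI by eventually_elim (use dL DERIV_unique in blast)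
    then have "((\<lambda>\<beta>. g1 \<beta> / \<beta> - g0 \<beta> / \<beta>^2) has_real_derivative 0) (at u)"
      using DERIV_cong_ev[OF refl, of L' "\<lambda>\<beta>. g1 \<beta> / \<beta> - g0 \<beta> / \<beta>^2" u 0 0] L'' by simp
    moreover have "((\<lambda>\<beta>. g1 \<beta> / \<beta> - g0 \<beta> / \<beta>^2) has_real_derivative K u / u^3) (at u)"
      using u AB unfolding K_def
      by (auto intro!: derivative_eq_intros d0 d1 simp: field_simps power2_eq_square power3_eq_cube)
    ultimately have "K u / u^3 = 0"
      by (rule DERIV_unique[symmetric])
    then show "u \<in> {u \<in> {A<..<B}. K u = 0}"
      using u AB by auto
  qed
  moreover have "finite {u \<in> {A<..<B}. K u = 0} \<and> card {u \<in> {A<..<B}. K u = 0} \<le> 2"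
    by (rule card_zeros_le_two[OF dK crit])
  ultimately show ?thesis
    using finite_subset card_mono[of "{u \<in> {A<..<B}. K u = 0}" S] by (meson le_trans)
qed

section \<open>Bounds for the Hausdorff measure\<close>

text \<open>Covers in the definition are indexed by the naturals. This form allows any countable
  index type, such as words, and bounds the series through finite subsums.\<close>

lemma hausdorff_measure_delta_le:
  fixes U :: "'i::countable \<Rightarrow> real set"
  assumes cover: "A \<subseteq> (\<Union>i\<in>S. U i)"
    and U: "\<And>i. i \<in> S \<Longrightarrow> bounded (U i)" "\<And>i. i \<in> S \<Longrightarrow> diameter (U i) \<le> \<delta>"
    and sum: "\<And>F. finite F \<Longrightarrow> F \<subseteq> S \<Longrightarrow> (\<Sum>i\<in>F. diameter (U i) powr s) \<le> b"
    and \<delta>: "0 \<le> \<delta>"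
  shows "hausdorff_measure_delta s \<delta> A \<le> ennreal b"
proof -
  \<comment> \<open>\<open>P\<close> keeps exactly one number for each element of \<open>S\<close>,
    so no set is repeated; all other positions receive the empty set, which contributes 0.\<close>
  define P where "P = (\<lambda>k. (from_nat k :: 'i) \<in> S \<and> to_nat (from_nat k :: 'i) = k)"
  define V where "V = (\<lambda>k. if P k then U (from_nat k) else {})"
  have "A \<subseteq> (\<Union>k. V k)"
  proof
    fix x assume "x \<in> A"
    then obtain i where "i \<in> S" "x \<in> U i"
      using cover by auto
    then have "x \<in> V (to_nat i)"
      by (simp add: V_def P_def)
    then show "x \<in> (\<Union>k. V k)" by blast
  qed
  moreover have "bounded (V k) \<and> diameter (V k) \<le> \<delta>" for k
    using U \<delta> by (auto simp: V_def P_def)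
  ultimately have V: "V \<in> {U. A \<subseteq> (\<Union>i. U i) \<and> (\<forall>i. bounded (U i) \<and> diameter (U i) \<le> \<delta>)}"
    by blast
  have "(\<Sum>k<N. ennreal (diameter (V k) powr s)) \<le> ennreal b" for N
  proof -
    define Q where "Q = {k. k < N \<and> P k}"
    have Q: "finite Q" by (simp add: Q_def)
    have inj: "inj_on (from_nat :: nat \<Rightarrow> 'i) Q"
      by (rule inj_on_inverseI[of _ to_nat]) (auto simp: Q_def P_def)
    have "(\<Sum>k<N. diameter (V k) powr s) = (\<Sum>k\<in>Q. diameter (U (from_nat k)) powr s)"
      by (rule sum.mono_neutral_cong_right) (auto simp: Q_def V_def)
    also have "\<dots> = (\<Sum>i\<in>from_nat ` Q. diameter (U i) powr s)"
      by (simp add: sum.reindex[OF inj])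
    also have "\<dots> \<le> b"
      using Q by (intro sum) (auto simp: Q_def P_def)
    finally show ?thesis
      by (subst sum_ennreal) (auto intro: ennreal_leI)
  qed
  then have "(\<Sum>k. ennreal (diameter (V k) powr s)) \<le> ennreal b"
    by (intro suminf_le_const) auto
  then show ?thesis
    unfolding hausdorff_measure_delta_def using V by (rule INF_lower2[rotated])
qed

text \<open>The inverse of \<open>f\<close> is Hoelder of exponent \<open>s\<close>, so a cover of
  \<open>A\<close> yields a cover of [0, 1) by intervals of length
  \<open>2 * C * diameter (U i) powr s\<close>. By Lebesgue measure these lengths sum to at least
  1.\<close>

lemma hausdorff_measure_nonzero_if_expanding:
  fixes f :: "real \<Rightarrow> real"
  assumes f: "\<And>t. t \<in> {0..<1} \<Longrightarrow> f t \<in> A"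
    and C: "0 < C"
    and expanding: "\<And>t t'. t \<in> {0..<1} \<Longrightarrow> t' \<in> {0..<1} \<Longrightarrow> \<bar>t - t'\<bar> \<le> C * \<bar>f t - f t'\<bar> powr s"
    and s: "0 < s"
  shows "hausdorff_measure s A \<noteq> 0"
proof -
  have "ennreal (1 / (2 * C)) \<le> hausdorff_measure_delta s 1 A"
    unfolding hausdorff_measure_delta_def
  proof (rule INF_greatest)
    fix U :: "nat \<Rightarrow> real set"
    assume "U \<in> {U. A \<subseteq> (\<Union>i. U i) \<and> (\<forall>i. bounded (U i) \<and> diameter (U i) \<le> 1)}"
    then have U: "A \<subseteq> (\<Union>i. U i)" "\<And>i. bounded (U i)" by auto
    define \<rho> where "\<rho> = (\<lambda>i. C * diameter (U i) powr s)"
    \<comment> \<open>If no parameter is mapped into \<open>U i\<close>, then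
      \<open>\<tau> i\<close> is arbitrary; the extra interval only enlarges the cover.\<close>
    define \<tau> where "\<tau> = (\<lambda>i. SOME t. t \<in> {0..<1} \<and> f t \<in> U i)"
    define J where "J = (\<lambda>i. {\<tau> i - \<rho> i..\<tau> i + \<rho> i})"
    have \<rho>: "0 \<le> \<rho> i" for i using C by (simp add: \<rho>_def)
    have sub: "{0..<1} \<subseteq> (\<Union>i. J i)"
    proof
      fix t :: real assume t: "t \<in> {0..<1}"
      then obtain i where i: "f t \<in> U i" using f U(1) by blast
      have \<tau>: "\<tau> i \<in> {0..<1}" "f (\<tau> i) \<in> U i"
        using someI[of "\<lambda>t. t \<in> {0..<1} \<and> f t \<in> U i" t] t i by (auto simp: \<tau>_def)
      have "\<bar>t - \<tau> i\<bar> \<le> C * \<bar>f t - f (\<tau> i)\<bar> powr s"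
        using expanding t \<tau>(1) by blast
      also have "\<dots> \<le> \<rho> i"
        using diameter_bounded_bound[OF U(2) i \<tau>(2)] C s
        unfolding \<rho>_def dist_real_def by (intro mult_left_mono powr_mono2) auto
      finally have "t \<in> J i" by (auto simp: J_def)
      then show "t \<in> (\<Union>i. J i)" by blast
    qed
    have "1 = emeasure lborel {0..<1::real}" by simp
    also have "\<dots> \<le> emeasure lborel (\<Union>i. J i)"
      using sub by (intro emeasure_mono) (auto simp: J_def)
    also have "\<dots> \<le> (\<Sum>i. emeasure lborel (J i))"
      by (intro emeasure_subadditive_countably) (auto simp: J_def)
    also have "\<dots> = (\<Sum>i. ennreal (2 * C) * ennreal (diameter (U i) powr s))"
    proof (intro suminf_cong)
      fix i
      have "emeasure lborel (J i) = ennreal (2 * \<rho> i)"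
        using \<rho>[of i] by (simp add: J_def)
      also have "\<dots> = ennreal (2 * C) * ennreal (diameter (U i) powr s)"
        using C by (simp add: \<rho>_def ennreal_mult'[symmetric] mult.assoc)
      finally show "emeasure lborel (J i) = ennreal (2 * C) * ennreal (diameter (U i) powr s)" .
    qed
    also have "\<dots> = ennreal (2 * C) * (\<Sum>i. ennreal (diameter (U i) powr s))"
      by simp
    finally have "1 \<le> ennreal (2 * C) * (\<Sum>i. ennreal (diameter (U i) powr s))" .
    then have "ennreal (1 / (2 * C)) * 1 \<le>
        ennreal (1 / (2 * C)) * (ennreal (2 * C) * (\<Sum>i. ennreal (diameter (U i) powr s)))"
      by (rule mult_left_mono) simp
    also have "\<dots> = ennreal (1 / (2 * C)) * ennreal (2 * C) * (\<Sum>i. ennreal (diameter (U i) powr s))"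
      by (rule mult.assoc[symmetric])
    also have "ennreal (1 / (2 * C)) * ennreal (2 * C) = 1"
      using C by (subst ennreal_mult'[symmetric]) auto
    finally show "ennreal (1 / (2 * C)) \<le> (\<Sum>i. ennreal (diameter (U i) powr s))"
      using C by simp
  qed
  moreover have "0 < ennreal (1 / (2 * C))"
    using C by simp
  ultimately have "0 < hausdorff_measure_delta s 1 A"
    by (rule less_le_trans[rotated])
  also have "\<dots> \<le> hausdorff_measure s A"
    unfolding hausdorff_measure_def by (rule SUP_upper) simp
  finally show ?thesis by simp
qed

section \<open>Inverse branches and cylinders\<close>

text \<open>
  \<open>orient i\<close> says that the branch \<open>i\<close> is increasing. The last assumption does not require \<open>x\<close> to
  determine \<open>i\<close>, since at a common endpoint \<open>T\<close> may follow either branch.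
\<close>

locale pl_branches =
  fixes n :: nat and l r :: "nat \<Rightarrow> real" and T :: "real \<Rightarrow> real" and orient :: "nat \<Rightarrow> bool"
  assumes branch_bounds: "i \<in> {1..n} \<Longrightarrow> 0 \<le> l i \<and> l i < r i \<and> r i \<le> 1"
    and branch_disjoint:
      "\<lbrakk>i \<in> {1..n}; j \<in> {1..n}; x \<in> {l i<..<r i}; x \<in> {l j<..<r j}\<rbrakk> \<Longrightarrow> i = j"
    and T_branch: "x \<in> pl_domain n l r \<Longrightarrow> \<exists>i\<in>{1..n}. T x \<in> {0..1} \<and>
      x = (if orient i then l i + (r i - l i) * T x else r i - (r i - l i) * T x)"
begin

definition inv_branch :: "nat \<Rightarrow> real \<Rightarrow> real" where
  "inv_branch i y = (if orient i then l i + (r i - l i) * y else r i - (r i - l i) * y)"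

text \<open>The first letter is applied last, so it names the branch interval that contains the
  point. Images of the unit interval are the cylinders.\<close>

definition inv_word :: "nat list \<Rightarrow> real \<Rightarrow> real" where
  "inv_word w = foldr inv_branch w"

text \<open>For words over the branches, \<open>exp (- log_slope w)\<close> is the length of the
  cylinder of \<open>w\<close>.\<close>

definition log_slope :: "nat list \<Rightarrow> real" where
  "log_slope w = (\<Sum>i\<leftarrow>w. ln (pl_slope l r i))"

definition word_sign :: "nat list \<Rightarrow> real" where
  "word_sign w = (\<Prod>i\<leftarrow>w. if orient i then 1 else - 1)"

abbreviation words :: "nat list set" where
  "words \<equiv> lists {1..n}"

lemma words_nth: "w \<in> words \<Longrightarrow> k < length w \<Longrightarrow> w ! k \<in> {1..n}"
  using nth_mem[of k w] by (simp only: in_lists_conv_set)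

lemma words_take: "w \<in> words \<Longrightarrow> take k w \<in> words"
  by (meson in_lists_conv_set in_set_takeD)

lemma words_drop: "w \<in> words \<Longrightarrow> drop k w \<in> words"
  by (meson in_lists_conv_set in_set_dropD)

lemma inv_word_simps [simp]:
  "inv_word [] y = y"
  "inv_word (i # w) y = inv_branch i (inv_word w y)"
  "inv_word (u @ w) y = inv_word u (inv_word w y)"
  by (simp_all add: inv_word_def)

lemma log_slope_simps [simp]:
  "log_slope [] = 0"
  "log_slope (i # w) = ln (pl_slope l r i) + log_slope w"
  "log_slope (u @ w) = log_slope u + log_slope w"
  by (simp_all add: log_slope_def)

lemma word_sign_simps [simp]:
  "word_sign [] = 1"
  "word_sign (i # w) = (if orient i then 1 else - 1) * word_sign w"
  by (simp_all add: word_sign_def)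

lemma word_sign_abs [simp]: "\<bar>word_sign w\<bar> = 1"
  by (induction w) (auto simp: abs_mult)

lemma exp_minus_ln_slope: "i \<in> {1..n} \<Longrightarrow> exp (- ln (pl_slope l r i)) = r i - l i"
  using branch_bounds[of i] by (auto simp: pl_slope_def ln_div exp_minus)

lemma inv_word_affine:
  assumes "w \<in> words"
  shows "inv_word w y = inv_word w 0 + word_sign w * exp (- log_slope w) * y"
  using assms
proof (induction w arbitrary: y)
  case (Cons i w)
  have e: "exp (- log_slope (i # w)) = (r i - l i) * exp (- log_slope w)"
    using exp_minus_ln_slope[OF Cons.hyps(1)] by (simp only: log_slope_simps minus_add_distrib exp_add)
  show ?case
    unfolding e by (simp add: Cons.IH[of y] inv_branch_def algebra_simps)
qed simp

lemma inv_word_dist: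
  assumes "w \<in> words"
  shows "\<bar>inv_word w y - inv_word w z\<bar> = exp (- log_slope w) * \<bar>y - z\<bar>"
proof -
  have "inv_word w y - inv_word w z = word_sign w * exp (- log_slope w) * (y - z)"
    using inv_word_affine[OF assms, of y] inv_word_affine[OF assms, of z]
    by (simp add: algebra_simps)
  then show ?thesis by (simp add: abs_mult)
qed

lemma inv_branch_open:
  assumes "i \<in> {1..n}" "y \<in> {0<..<1}"
  shows "inv_branch i y \<in> {l i<..<r i}"
proof -
  have "0 < (r i - l i) * y" "(r i - l i) * y < (r i - l i) * 1"
    using assms branch_bounds[of i] by (auto intro!: mult_strict_left_mono)
  then show ?thesis by (auto simp: inv_branch_def)
qed

lemma inv_branch_closed:
  assumes "i \<in> {1..n}" "y \<in> {0..1}"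
  shows "inv_branch i y \<in> {l i..r i}"
proof -
  have "0 \<le> (r i - l i) * y" "(r i - l i) * y \<le> (r i - l i) * 1"
    using assms branch_bounds[of i] by (auto intro!: mult_left_mono)
  then show ?thesis by (auto simp: inv_branch_def)
qed

lemma inv_word_open: "w \<in> words \<Longrightarrow> y \<in> {0<..<1} \<Longrightarrow> inv_word w y \<in> {0<..<1}"
proof (induction w)
  case (Cons i w)
  then have "inv_branch i (inv_word w y) \<in> {l i<..<r i}"
    by (intro inv_branch_open) auto
  with branch_bounds[of i] Cons.prems show ?case by auto
qed simp

lemma inv_word_closed: "w \<in> words \<Longrightarrow> y \<in> {0..1} \<Longrightarrow> inv_word w y \<in> {0..1}"
proof (induction w)
  case (Cons i w)
  then have "inv_branch i (inv_word w y) \<in> {l i..r i}"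
    by (intro inv_branch_closed) auto
  with branch_bounds[of i] Cons.prems show ?case by auto
qed simp

text \<open>An interior point of a branch interval belongs to no other one, so the branch provided
  by \<open>T_branch\<close> is \<open>i\<close>; at an endpoint \<open>T\<close> may follow a
  neighbouring branch.\<close>

lemma T_inv_branch:
  assumes i: "i \<in> {1..n}" and y: "y \<in> {0<..<1}"
  shows "T (inv_branch i y) = y"
proof -
  define x where "x = inv_branch i y"
  have x: "x \<in> {l i<..<r i}"
    unfolding x_def using inv_branch_open[OF i y] .
  then have "x \<in> pl_domain n l r"
    using i by (force simp: pl_domain_def)
  from T_branch[OF this] obtain j where j: "j \<in> {1..n}" "T x \<in> {0..1}" "x = inv_branch j (T x)"
    by (auto simp: inv_branch_def)
  have xj: "x \<in> {l j..r j}"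
    using inv_branch_closed[OF j(1,2)] j(3) by simp
  \<comment> \<open>otherwise a point near \<open>x\<close> lies in the interior of both branch intervals\<close>
  have "i = j"
  proof (cases "x < r j")
    case True
    have "(x + min (r i) (r j)) / 2 \<in> {l i<..<r i}" "(x + min (r i) (r j)) / 2 \<in> {l j<..<r j}"
      using True x xj by (auto simp: min_def)
    then show ?thesis using branch_disjoint i j(1) by blast
  next
    case False
    have "(x + max (l i) (l j)) / 2 \<in> {l i<..<r i}" "(x + max (l i) (l j)) / 2 \<in> {l j<..<r j}"
      using False x xj branch_bounds[OF j(1)] by (auto simp: max_def)
    then show ?thesis using branch_disjoint i j(1) by blast
  qed
  then have "inv_branch i (T x) = inv_branch i y"
    using j(3) x_def by simp
  then show ?thesis
    using branch_bounds[OF i] by (auto simp: inv_branch_def x_def split: if_splits)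
qed

lemma T_inv_word:
  assumes "u \<in> words" "w \<in> words" "y \<in> {0<..<1}"
  shows "(T ^^ length u) (inv_word (u @ w) y) = inv_word w y"
  using assms
proof (induction u)
  case (Cons i u)
  have "inv_word (u @ w) y \<in> {0<..<1}"
    using Cons by (intro inv_word_open) auto
  then have "T (inv_word ((i # u) @ w) y) = inv_word (u @ w) y"
    using T_inv_branch[of i "inv_word (u @ w) y"] Cons.hyps by simp
  then show ?case
    using Cons by (simp add: funpow_Suc_right del: funpow.simps)
qed simp

lemma T_inv_word_take:
  assumes "w \<in> words" "y \<in> {0<..<1}" "k \<le> length w"
  shows "(T ^^ k) (inv_word w y) = inv_word (drop k w) y"
proof -
  have "take k w \<in> words" "drop k w \<in> words"
    using assms(1) words_take words_drop by blast+
  from T_inv_word[OF this assms(2)] show ?thesis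
    using assms(3) by simp
qed

lemma T_inv_word_branch:
  assumes "w \<in> words" "y \<in> {0<..<1}" "k < length w"
  shows "(T ^^ k) (inv_word w y) \<in> {l (w ! k)<..<r (w ! k)}"
proof -
  have "drop (Suc k) w \<in> words" "w ! k \<in> {1..n}"
    using assms(1,3) words_nth words_drop by blast+
  then show ?thesis
    using T_inv_word_take[OF assms(1,2), of k] assms(2,3)
      inv_branch_open[of "w ! k" "inv_word (drop (Suc k) w) y"] inv_word_open[of "drop (Suc k) w" y]
    by (simp add: Cons_nth_drop_Suc[symmetric])
qed

lemma inv_word_iterate_domain:
  assumes "w \<in> words" "y \<in> {0<..<1}"
  shows "inv_word w y \<in> iterate_domain n l r T (length w)"
proof -
  have "(T ^^ k) (inv_word w y) \<in> pl_domain n l r" if "k < length w" for k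
  proof -
    have "w ! k \<in> {1..n}"
      using assms(1) that words_nth by blast
    then show ?thesis
      using T_inv_word_branch[OF assms that] by (force simp: pl_domain_def)
  qed
  then show ?thesis by (auto simp: iterate_domain_def)
qed

text \<open>The \<open>k\<close>-th iterate of the common point lies in the open branch intervals of
  both \<open>k\<close>-th letters, which therefore agree.\<close>

lemma inv_word_open_disjoint:
  assumes "w \<in> words" "w' \<in> words" "length w = length w'" "y \<in> {0<..<1}" "y' \<in> {0<..<1}"
    and "inv_word w y = inv_word w' y'"
  shows "w = w'"
proof (rule nth_equalityI)
  fix k assume k: "k < length w"
  have "w ! k \<in> {1..n}" "w' ! k \<in> {1..n}"
    using words_nth[OF assms(1) k] words_nth[OF assms(2), of k] k assms(3) by simp_all
  moreover have "(T ^^ k) (inv_word w y) \<in> {l (w ! k)<..<r (w ! k)}"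
    using T_inv_word_branch[OF assms(1,4) k] .
  moreover have "(T ^^ k) (inv_word w y) \<in> {l (w' ! k)<..<r (w' ! k)}"
    using T_inv_word_branch[OF assms(2,5)] k assms(3,6) by simp
  ultimately show "w ! k = w' ! k"
    using branch_disjoint by blast
qed (use assms in simp)

text \<open>The inverse affine map in explicit form, valid on the whole line; with a singleton
  \<open>S\<close> it solves \<open>z = inv_word w y\<close> for \<open>y\<close>.\<close>

lemma inv_word_image:
  assumes "w \<in> words"
  shows "z \<in> inv_word w ` S \<longleftrightarrow> (z - inv_word w 0) * word_sign w * exp (log_slope w) \<in> S"
proof -
  have s: "word_sign w * word_sign w = 1"
    using word_sign_abs[of w] by (metis abs_mult_self_eq mult_1)
  have e: "exp (- log_slope w) * exp (log_slope w) = 1"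
    by (simp add: exp_minus)
  have 1: "(inv_word w y - inv_word w 0) * word_sign w * exp (log_slope w) = y" for y
  proof -
    have "(inv_word w y - inv_word w 0) * word_sign w * exp (log_slope w)
        = (word_sign w * word_sign w) * (exp (- log_slope w) * exp (log_slope w)) * y"
      by (subst inv_word_affine[OF assms, of y]) (simp add: algebra_simps)
    then show ?thesis by (simp add: s e)
  qed
  have 2: "inv_word w ((z - inv_word w 0) * word_sign w * exp (log_slope w)) = z"
  proof -
    have "inv_word w ((z - inv_word w 0) * word_sign w * exp (log_slope w))
      = inv_word w 0 + (word_sign w * word_sign w) * (exp (- log_slope w) * exp (log_slope w)) * (z - inv_word w 0)"
      by (subst inv_word_affine[OF assms]) (simp add: algebra_simps)
    then show ?thesis by (simp add: s e)
  qed
  show ?thesis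
  proof
    assume "z \<in> inv_word w ` S"
    then show "(z - inv_word w 0) * word_sign w * exp (log_slope w) \<in> S"
      using 1 by auto
  next
    assume "(z - inv_word w 0) * word_sign w * exp (log_slope w) \<in> S"
    then show "z \<in> inv_word w ` S"
      using 2 by (metis imageI)
  qed
qed

section \<open>Derivatives of the iterates on cylinders\<close>

lemma T_funpow_on_cylinder:
  assumes "w \<in> words" "z \<in> inv_word w ` {0<..<1}"
  shows "(T ^^ length w) z = (z - inv_word w 0) * word_sign w * exp (log_slope w)"
proof -
  define y where "y = (z - inv_word w 0) * word_sign w * exp (log_slope w)"
  have y: "y \<in> {0<..<1}"
    using assms inv_word_image by (auto simp: y_def)
  obtain y' where y': "y' \<in> {0<..<1}" "z = inv_word w y'"
    using assms(2) by auto
  then have "(T ^^ length w) z = y'"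
    using T_inv_word[of w "[]" y'] assms(1) by simp
  moreover have "y \<in> {y'}"
    using inv_word_image[OF assms(1), of z "{y'}"] y'(2) by (auto simp: y_def)
  ultimately show ?thesis by (simp add: y_def)
qed

lemma open_inv_word_image:
  assumes "w \<in> words"
  shows "open (inv_word w ` {0<..<1})"
proof -
  have "inv_word w ` {0<..<1} = (\<lambda>z. (z - inv_word w 0) * word_sign w * exp (log_slope w)) -` {0<..<1}"
    using inv_word_image[OF assms] by auto
  then show ?thesis
    by (simp, intro open_vimage continuous_intros)
qed

lemma T_funpow_deriv:
  assumes "w \<in> words" "x \<in> inv_word w ` {0<..<1}"
  shows "((T ^^ length w) has_real_derivative word_sign w * exp (log_slope w)) (at x)"
proof (rule has_field_derivative_transform_within_open)
  show "((\<lambda>z. (z - inv_word w 0) * word_sign w * exp (log_slope w)) has_real_derivative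
      word_sign w * exp (log_slope w)) (at x)"
    by (auto intro!: derivative_eq_intros)
  show "open (inv_word w ` {0<..<1})"
    using open_inv_word_image[OF assms(1)] .
qed (use assms T_funpow_on_cylinder in auto)

text \<open>
  The derivative within the domain of the iterate may be one-sided, but it is determined, as \<open>x\<close> is a
  limit point of the open cylinder of any of its codes.
\<close>

lemma T_funpow_deriv_within:
  assumes w: "w \<in> words" and x: "x = inv_word w ((T ^^ length w) x)" "(T ^^ length w) x \<in> {0..1}"
    and D: "((T ^^ length w) has_real_derivative D) (at x within iterate_domain n l r T (length w))"
  shows "ln \<bar>D\<bar> = log_slope w"
proof -
  define f where "f = (\<lambda>z. (z - inv_word w 0) * word_sign w * exp (log_slope w))"
  define C where "C = inv_word w ` {0<..<1}"
  define y where "y = (T ^^ length w) x"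
  have "C \<subseteq> iterate_domain n l r T (length w)"
    unfolding C_def using inv_word_iterate_domain[OF w] by auto
  then have 1: "((T ^^ length w) has_real_derivative D) (at x within C)"
    using D DERIV_subset by blast
  have fx: "(T ^^ length w) x = f x"
    using inv_word_image[OF w, of x "{y}"] x unfolding f_def y_def by auto
  \<comment> \<open>If \<open>x\<close> is an endpoint of the cylinder, it lies outside
    \<open>C\<close>; it is adjoined because the comparison with \<open>f\<close> also needs
    equality at \<open>x\<close>.\<close>
  have "((T ^^ length w) has_real_derivative word_sign w * exp (log_slope w)) (at x within insert x C)"
  proof (rule has_field_derivative_transform_within[where d=1 and f=f])
    show "(f has_real_derivative word_sign w * exp (log_slope w)) (at x within insert x C)"
      unfolding f_def by (auto intro!: derivative_eq_intros)
  qed (use fx T_funpow_on_cylinder[OF w] in \<open>auto simp: C_def f_def\<close>)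
  then have 2: "((T ^^ length w) has_real_derivative word_sign w * exp (log_slope w)) (at x within C)"
    using DERIV_subset by blast
  have lim: "x islimpt C"
  proof -
    have "y islimpt {0<..<1}"
    proof (cases "y = 1")
      case True
      then show ?thesis by (simp add: islimpt_greaterThanLessThan2)
    next
      case False
      then have "y islimpt {y<..<1}"
        using x(2) by (intro islimpt_greaterThanLessThan1) (auto simp: y_def)
      then show ?thesis
        by (rule islimpt_subset) (use x(2) in \<open>auto simp: y_def\<close>)
    qed
    show ?thesis
      unfolding islimpt_approachable
    proof (intro allI impI)
      fix e :: real assume "0 < e"
      then have "0 < e * exp (log_slope w)" by simp
      then obtain y' where y': "y' \<in> {0<..<1}" "y' \<noteq> y" "dist y' y < e * exp (log_slope w)"
        using \<open>y islimpt {0<..<1}\<close> unfolding islimpt_approachable by blast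
      have d: "\<bar>inv_word w y' - x\<bar> = exp (- log_slope w) * \<bar>y' - y\<bar>"
        using inv_word_dist[OF w, of y' y] x(1) by (simp add: y_def)
      have "exp (- log_slope w) * \<bar>y' - y\<bar> < e"
        using y'(3) by (simp add: dist_real_def exp_minus field_simps)
      moreover have "inv_word w y' \<noteq> x"
        using d y'(2) by auto
      ultimately show "\<exists>x'\<in>C. x' \<noteq> x \<and> dist x' x < e"
        using y'(1) d by (intro bexI[of _ "inv_word w y'"]) (auto simp: C_def dist_real_def)
    qed
  qed
  then have "D = word_sign w * exp (log_slope w)"
    using 1 2 by (intro has_field_derivative_unique[of _ D x C]) (auto simp: trivial_limit_within)
  then show ?thesis
    by (simp add: abs_mult)
qed

section \<open>Symbolic coding and separation of cylinders\<close>

lemma repeller_coding: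
  assumes "x \<in> repeller n l r T"
  obtains \<omega> where "\<And>k. \<omega> k \<in> {1..n}" "\<And>m. x = inv_word (map \<omega> [0..<m]) ((T ^^ m) x)"
    "\<And>m. (T ^^ m) x \<in> {0..1}"
proof -
  \<comment> \<open>The letters are chosen independently for each point of the orbit, as a branch
    that \<open>T\<close> follows there.\<close>
  have "\<forall>k. \<exists>i\<in>{1..n}. T ((T ^^ k) x) \<in> {0..1} \<and> (T ^^ k) x = inv_branch i (T ((T ^^ k) x))"
  proof
    fix k
    have "(T ^^ k) x \<in> pl_domain n l r"
      using assms by (auto simp: repeller_def)
    then show "\<exists>i\<in>{1..n}. T ((T ^^ k) x) \<in> {0..1} \<and> (T ^^ k) x = inv_branch i (T ((T ^^ k) x))"
      using T_branch by (auto simp: inv_branch_def)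
  qed
  then obtain \<omega> where w: "\<And>k. \<omega> k \<in> {1..n}" "\<And>k. T ((T ^^ k) x) \<in> {0..1}"
      "\<And>k. (T ^^ k) x = inv_branch (\<omega> k) (T ((T ^^ k) x))"
    by metis
  have "x = inv_word (map \<omega> [0..<m]) ((T ^^ m) x)" for m
  proof (induction m)
    case (Suc m)
    then show ?case
      using w(3)[of m] by simp
  qed simp
  moreover have "(T ^^ m) x \<in> {0..1}" for m
    using inv_branch_closed[OF w(1,2), of m m] branch_bounds[OF w(1), of m] w(3)[of m] by auto
  ultimately show ?thesis
    using that w(1) by blast
qed

lemma bounded_cylinder: "w \<in> words \<Longrightarrow> bounded (inv_word w ` {0..1})"
  using inv_word_closed by (intro bounded_subset[OF bounded_closed_interval[of 0 1]] image_subsetI)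

lemma diameter_cylinder: "w \<in> words \<Longrightarrow> diameter (inv_word w ` {0..1}) \<le> exp (- log_slope w)"
proof (rule diameter_le)
  fix x y assume "w \<in> words" "x \<in> inv_word w ` {0..1}" "y \<in> inv_word w ` {0..1}"
  then obtain x' y' where xy: "x = inv_word w x'" "y = inv_word w y'" "x' \<in> {0..1}" "y' \<in> {0..1}"
    by auto
  then have "\<bar>x - y\<bar> = exp (- log_slope w) * \<bar>x' - y'\<bar>"
    using inv_word_dist \<open>w \<in> words\<close> by simp
  also have "\<dots> \<le> exp (- log_slope w) * 1"
    using xy by (intro mult_left_mono) auto
  finally show "norm (x - y) \<le> exp (- log_slope w)" by simp
qed auto

text \<open>At a smaller distance the second point would also lie in the open cylinder of
  \<open>u\<close>, because \<open>z\<close> has margin \<delta>; but open cylinders of distinct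
  words of equal length are disjoint.\<close>

lemma inv_word_separated:
  assumes u: "u \<in> words" "u' \<in> words" "length u = length u'" "u \<noteq> u'"
    and z: "z \<in> {\<delta>..1 - \<delta>}" "z' \<in> {\<delta>..1 - \<delta>}" and \<delta>: "0 < \<delta>"
  shows "\<delta> * exp (- log_slope u) \<le> \<bar>inv_word u z - inv_word u' z'\<bar>"
proof (rule ccontr)
  define x where "x = inv_word u' z'"
  define y where "y = (x - inv_word u 0) * word_sign u * exp (log_slope u)"
  have x: "x = inv_word u y"
    using inv_word_image[OF u(1), of x "{y}"] by (auto simp: y_def)
  assume "\<not> ?thesis"
  then have "exp (- log_slope u) * \<bar>z - y\<bar> < exp (- log_slope u) * \<delta>"
    using inv_word_dist[OF u(1), of z y] x by (simp add: x_def mult.commute)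
  then have "\<bar>z - y\<bar> < \<delta>"
    by simp
  then have "y \<in> {0<..<1}" "z' \<in> {0<..<1}"
    using z \<delta> by (auto simp: abs_less_iff)
  then have "u = u'"
    using inv_word_open_disjoint[OF u(1-3), of y z'] x x_def by simp
  with u(4) show False by simp
qed

text \<open>A branch interval may touch 0 or 1, but some cylinder of length two stays away from
  both.\<close>

lemma inner_cylinder_exists:
  assumes "2 \<le> n"
  obtains v \<delta> where "v \<in> words" "v \<noteq> []" "0 < \<delta>"
    "\<And>y. y \<in> {0..1} \<Longrightarrow> inv_word v y \<in> {\<delta>..1 - \<delta>}"
proof -
  have ordered: "r i \<le> l j \<or> r j \<le> l i" if ij: "i \<in> {1..n}" "j \<in> {1..n}" "i \<noteq> j" for i j
  proof (rule ccontr)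
    assume "\<not> ?thesis"
    then have "(max (l i) (l j) + min (r i) (r j)) / 2 \<in> {l i<..<r i}"
        "(max (l i) (l j) + min (r i) (r j)) / 2 \<in> {l j<..<r j}"
      using branch_bounds[OF ij(1)] branch_bounds[OF ij(2)] by (auto simp: max_def min_def)
    then show False using branch_disjoint ij by blast
  qed
  have "1 \<in> {1..n}" "2 \<in> {1..n}" using assms by auto
  then obtain i j where ij: "i \<in> {1..n}" "j \<in> {1..n}" "r i \<le> l j"
    using ordered[of 1 2] by fastforce
  \<comment> \<open>Interval \<open>i\<close> lies to the left of interval \<open>j\<close>, so
    \<open>r i < 1\<close>. Its left end is the image of 0 or of 1, depending on the orientation;
    the second letter is chosen so that its interval avoids that preimage.\<close>
  define k where "k = (if orient i then j else i)"
  have k: "k \<in> {1..n}" using ij by (simp add: k_def)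
  have bi: "0 \<le> l i" "l i < r i" "r i < 1" and bj: "0 < l j" "l j < r j" "r j \<le> 1"
    using ij branch_bounds[of i] branch_bounds[of j] by auto
  define \<delta> where "\<delta> = (r i - l i) * (if orient i then l j else 1 - r i)"
  define \<delta>' where "\<delta>' = min \<delta> (1 - r i)"
  have "0 < \<delta>'" using bi bj by (simp add: \<delta>'_def \<delta>_def)
  moreover have "inv_word [i, k] y \<in> {\<delta>'..1 - \<delta>'}" if "y \<in> {0..1}" for y
  proof -
    define z where "z = inv_branch k y"
    have z: "z \<in> {l k..r k}" unfolding z_def by (rule inv_branch_closed[OF k that])
    have "inv_branch i z \<le> r i"
      using inv_branch_closed[OF ij(1), of z] z branch_bounds[OF k] by auto
    moreover have "\<delta> \<le> inv_branch i z"
    proof (cases "orient i")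
      case True
      then have "(r i - l i) * l j \<le> (r i - l i) * z"
        using z bi by (intro mult_left_mono) (auto simp: k_def)
      also have "\<dots> \<le> inv_branch i z"
        using True bi by (simp add: inv_branch_def)
      finally show ?thesis using True by (simp add: \<delta>_def)
    next
      case False
      then have "(r i - l i) * z \<le> (r i - l i) * r i"
        using z bi by (intro mult_left_mono) (auto simp: k_def)
      then show ?thesis using False bi by (simp add: inv_branch_def \<delta>_def algebra_simps)
    qed
    ultimately show ?thesis by (auto simp: \<delta>'_def z_def)
  qed
  ultimately show ?thesis
    using that[of "[i, k]" \<delta>'] ij(1) k by auto
qed

end

section \<open>Upper bound for the dimension of a level set\<close>

lemma sum_geometric_tail_le:
  fixes q :: real
  assumes "0 < q" "q < 1"
  shows "(\<Sum>m=K..M. q ^ m) \<le> q ^ K / (1 - q)"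
proof -
  have "0 \<le> q ^ K" "0 \<le> q ^ Suc M" using assms by simp_all
  then show ?thesis
    using assms by (auto simp: sum_gp divide_right_mono)
qed

text \<open>
  The exponentials are the probabilities of the Bernoulli measure which, among those with Lyapunov
  exponent \<open>\<alpha>\<close>, has maximal entropy; this entropy is \<open>g\<close>. For \<open>c = - t\<close> and \<open>\<alpha> = F'(t) / F(t)\<close>
  this is the parametrization of the spectrum by \<open>F(t) = \<Sum> x\<^sub>i\<^sup>t\<close>.
\<close>

locale gibbs_weights = pl_branches +
  fixes \<alpha> c g :: real
  assumes two_branches: "2 \<le> n"
    and exponent_pos: "0 < \<alpha>"
    and gibbs_sum: "(\<Sum>i=1..n. exp (- (g + c * (ln (pl_slope l r i) - \<alpha>)))) = 1"
    and gibbs_mean: "(\<Sum>i=1..n. exp (- (g + c * (ln (pl_slope l r i) - \<alpha>)))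
                        * (ln (pl_slope l r i) - \<alpha>)) = 0"
begin

definition level :: "real set" where
  "level = {x \<in> repeller n l r T. has_lyapunov_exponent n l r T x \<alpha>}"

text \<open>Sum of the centred log-slopes of the letters: under the Bernoulli measure, a random walk
  with independent steps.\<close>

definition deviation :: "nat list \<Rightarrow> real" where
  "deviation w = log_slope w - \<alpha> * length w"

text \<open>Bernoulli mass of the cylinder, which depends on the letters only through length and
  deviation.\<close>

definition weight :: "nat list \<Rightarrow> real" where
  "weight w = exp (- (g * length w + c * deviation w))"

definition words_of :: "nat \<Rightarrow> nat list set" where
  "words_of m = {w \<in> words. length w = m}"

lemma deviation_simps [simp]:
  "deviation [] = 0"
  "deviation (i # w) = (ln (pl_slope l r i) - \<alpha>) + deviation w"
  "deviation (u @ w) = deviation u + deviation w"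
  by (simp_all add: deviation_def algebra_simps)

lemma weight_simps [simp]:
  "weight [] = 1"
  "weight (i # w) = exp (- (g + c * (ln (pl_slope l r i) - \<alpha>))) * weight w"
  by (simp_all add: weight_def exp_add[symmetric] algebra_simps)

lemma weight_pos: "0 < weight w"
  by (simp add: weight_def)

lemma words_of_0: "words_of 0 = {[]}"
  by (auto simp: words_of_def)

lemma finite_words_of: "finite (words_of m)"
  using finite_lists_length_eq[of "{1..n}" m] by (simp add: words_of_def lists_eq_set)

lemma sum_words_of_Suc:
  "(\<Sum>w\<in>words_of (Suc m). f w) = (\<Sum>i=1..n. \<Sum>w\<in>words_of m. f (i # w))"
proof -
  have "words_of (Suc m) = (\<lambda>(i, w). i # w) ` ({1..n} \<times> words_of m)"
    by (auto simp: words_of_def length_Suc_conv image_iff)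
  moreover have "inj_on (\<lambda>(i, w). i # w) ({1..n} \<times> words_of m)"
    by (auto simp: inj_on_def)
  ultimately have "(\<Sum>w\<in>words_of (Suc m). f w) = (\<Sum>(i, w)\<in>{1..n} \<times> words_of m. f (i # w))"
    by (simp add: sum.reindex case_prod_unfold)
  then show ?thesis
    by (simp add: sum.cartesian_product)
qed

section \<open>Moments of the deviation\<close>

lemma sum_weight: "(\<Sum>w\<in>words_of m. weight w) = 1"
proof (induction m)
  case (Suc m)
  then show ?case
    using gibbs_sum by (simp add: sum_words_of_Suc flip: sum_distrib_left)
qed (simp add: words_of_0)

lemma sum_weight_deviation: "(\<Sum>w\<in>words_of m. weight w * deviation w) = 0"
proof (induction m)
  case (Suc m)
  let ?z = "\<lambda>i. ln (pl_slope l r i) - \<alpha>"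
  let ?\<mu> = "\<lambda>i. exp (- (g + c * ?z i))"
  have "(\<Sum>w\<in>words_of (Suc m). weight w * deviation w)
      = (\<Sum>i=1..n. ?\<mu> i * ?z i * (\<Sum>w\<in>words_of m. weight w)
          + ?\<mu> i * (\<Sum>w\<in>words_of m. weight w * deviation w))"
    unfolding sum_words_of_Suc sum_distrib_left
    by (intro sum.cong refl) (simp add: sum.distrib[symmetric] algebra_simps)
  then show ?case
    using gibbs_mean by (simp add: Suc sum_weight)
qed (simp add: words_of_0)

definition variance :: real where
  "variance = (\<Sum>i=1..n. exp (- (g + c * (ln (pl_slope l r i) - \<alpha>)))
                 * (ln (pl_slope l r i) - \<alpha>)\<^sup>2)"

text \<open>The steps are independent with mean zero, so cross terms vanish and variances add
  up.\<close>

lemma sum_weight_deviation_sq: "(\<Sum>w\<in>words_of m. weight w * (deviation w)\<^sup>2) = m * variance"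
proof (induction m)
  case (Suc m)
  let ?z = "\<lambda>i. ln (pl_slope l r i) - \<alpha>"
  let ?\<mu> = "\<lambda>i. exp (- (g + c * ?z i))"
  have "(\<Sum>w\<in>words_of (Suc m). weight w * (deviation w)\<^sup>2)
      = (\<Sum>i=1..n. ?\<mu> i * (?z i)\<^sup>2 * (\<Sum>w\<in>words_of m. weight w)
          + 2 * ?\<mu> i * ?z i * (\<Sum>w\<in>words_of m. weight w * deviation w)
          + ?\<mu> i * (\<Sum>w\<in>words_of m. weight w * (deviation w)\<^sup>2))"
    unfolding sum_words_of_Suc sum_distrib_left
    by (intro sum.cong refl) (simp add: sum.distrib[symmetric] algebra_simps power2_eq_square)
  also have "\<dots> = variance + m * variance"
    using gibbs_sum
    by (simp add: Suc sum_weight sum_weight_deviation sum.distrib variance_def flip: sum_distrib_right)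
  finally show ?case by (simp add: algebra_simps)
qed (simp add: words_of_0)

text \<open>\<open>g\<close> is the Shannon entropy of the letter distribution: the average of minus
  the logarithms of probabilities, each at most 1, where the term with \<open>c\<close> averages to
  0.\<close>

lemma entropy_nonneg: "0 \<le> g"
proof -
  let ?z = "\<lambda>i. ln (pl_slope l r i) - \<alpha>"
  let ?\<mu> = "\<lambda>i. exp (- (g + c * ?z i))"
  have "0 \<le> ?\<mu> i * (g + c * ?z i)" if "i \<in> {1..n}" for i
  proof -
    have "?\<mu> i \<le> 1"
      using member_le_sum[of i "{1..n}" ?\<mu>] that gibbs_sum by simp
    then show ?thesis by simp
  qed
  then have "0 \<le> (\<Sum>i=1..n. ?\<mu> i * (g + c * ?z i))"
    by (rule sum_nonneg)
  also have "\<dots> = (\<Sum>i=1..n. g * ?\<mu> i + c * (?\<mu> i * ?z i))"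
    by (intro sum.cong) (auto simp: algebra_simps)
  also have "\<dots> = g * (\<Sum>i=1..n. ?\<mu> i) + c * (\<Sum>i=1..n. ?\<mu> i * ?z i)"
    by (simp only: sum.distrib sum_distrib_left)
  finally show ?thesis
    by (simp only: gibbs_sum gibbs_mean)
qed

section \<open>Coverings by long cylinders\<close>

lemma level_coding:
  assumes "x \<in> level"
  obtains \<omega> where "\<And>k. \<omega> k \<in> {1..n}" "\<And>m. x \<in> inv_word (map \<omega> [0..<m]) ` {0..1}"
    "(\<lambda>m. log_slope (map \<omega> [0..<m]) / m) \<longlonglongrightarrow> \<alpha>"
proof -
  have "x \<in> repeller n l r T" using assms by (simp add: level_def)
  then obtain \<omega> where \<omega>: "\<And>k. \<omega> k \<in> {1..n}" "\<And>m. x = inv_word (map \<omega> [0..<m]) ((T ^^ m) x)"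
    "\<And>m. (T ^^ m) x \<in> {0..1}"
    by (rule repeller_coding) blast
  obtain D where D: "\<And>m. ((T ^^ m) has_real_derivative D m) (at x within iterate_domain n l r T m)"
      "(\<lambda>m. 1 / real m * ln \<bar>D m\<bar>) \<longlonglongrightarrow> \<alpha>"
    using assms by (auto simp: level_def has_lyapunov_exponent_def)
  have "ln \<bar>D m\<bar> = log_slope (map \<omega> [0..<m])" for m
    using T_funpow_deriv_within[of "map \<omega> [0..<m]" x "D m"] \<omega> D(1)[of m]
    by (simp add: in_lists_conv_set del: One_nat_def atLeastAtMost_iff)
  then have "(\<lambda>m. log_slope (map \<omega> [0..<m]) / m) \<longlonglongrightarrow> \<alpha>"
    using D(2) by simp
  moreover have "x \<in> inv_word (map \<omega> [0..<m]) ` {0..1}" for m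
    using \<omega>(2,3)[of m] by blast
  ultimately show ?thesis using that \<omega>(1) by blast
qed

text \<open>For a word of small relative deviation, the \<open>s\<close>-th power of the diameter is
  at most its weight times \<open>q ^ length w\<close>. The weights of each length sum to 1, so the
  words of length at least \<open>K\<close> contribute at most a geometric tail.\<close>

lemma hausdorff_measure_level_zero:
  assumes s: "0 < s" "g < s * \<alpha>"
  shows "hausdorff_measure s level = 0"
proof -
  \<comment> \<open>The first bound keeps diameters below
    \<open>exp (- \<alpha> / 2 * length w)\<close>; the second lets deviations consume at most half
    of the gap \<open>s * \<alpha> - g\<close>, leaving \<eta> per letter.\<close>
  define \<epsilon> where "\<epsilon> = min (\<alpha> / 2) ((s * \<alpha> - g) / (2 * (\<bar>c\<bar> + s)))"
  define \<eta> where "\<eta> = (s * \<alpha> - g) / 2"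
  define q where "q = exp (- \<eta>)"
  have \<eta>: "0 < \<eta>" using s by (simp add: \<eta>_def)
  have q: "0 < q" "q < 1" using \<eta> by (simp_all add: q_def)
  have \<epsilon>: "0 < \<epsilon>" "\<epsilon> \<le> \<alpha> / 2" "(\<bar>c\<bar> + s) * \<epsilon> \<le> \<eta>"
  proof -
    show "0 < \<epsilon>" using s exponent_pos by (auto simp: \<epsilon>_def)
    show "\<epsilon> \<le> \<alpha> / 2" unfolding \<epsilon>_def by (rule min.cobounded1)
    have "(\<bar>c\<bar> + s) * \<epsilon> \<le> (\<bar>c\<bar> + s) * ((s * \<alpha> - g) / (2 * (\<bar>c\<bar> + s)))"
      using s by (intro mult_left_mono) (auto simp: \<epsilon>_def)
    also have "\<dots> = \<eta>"
    proof -
      have "\<bar>c\<bar> + s \<noteq> 0" using s by auto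
      then show ?thesis
        unfolding \<eta>_def times_divide_eq_right mult.commute[of 2] by (rule mult_divide_mult_cancel_left)
    qed
    finally show "(\<bar>c\<bar> + s) * \<epsilon> \<le> \<eta>" .
  qed
  define good where "good = (\<lambda>K. {w \<in> words. K \<le> length w \<and> \<bar>deviation w\<bar> \<le> \<epsilon> * length w})"
  have cover: "level \<subseteq> (\<Union>w\<in>good K. inv_word w ` {0..1})" for K
  proof
    fix x assume "x \<in> level"
    then obtain \<omega> where \<omega>: "\<And>k. \<omega> k \<in> {1..n}" "\<And>m. x \<in> inv_word (map \<omega> [0..<m]) ` {0..1}"
      and lim: "(\<lambda>m. log_slope (map \<omega> [0..<m]) / m) \<longlonglongrightarrow> \<alpha>"
      using level_coding by blast
    have "\<forall>\<^sub>F m in sequentially. dist (log_slope (map \<omega> [0..<m]) / m) \<alpha> < \<epsilon>"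
      using tendstoD[OF lim] \<epsilon>(1) by blast
    then have "\<forall>\<^sub>F m in sequentially. dist (log_slope (map \<omega> [0..<m]) / m) \<alpha> < \<epsilon> \<and> K \<le> m \<and> 1 \<le> m"
      by (intro eventually_conj eventually_ge_at_top)
    then obtain m where m: "\<bar>log_slope (map \<omega> [0..<m]) / m - \<alpha>\<bar> < \<epsilon>" "K \<le> m" "1 \<le> m"
      unfolding eventually_sequentially dist_real_def by blast
    have "\<bar>deviation (map \<omega> [0..<m])\<bar> = \<bar>log_slope (map \<omega> [0..<m]) / m - \<alpha>\<bar> * m"
    proof -
      have "deviation (map \<omega> [0..<m]) = (log_slope (map \<omega> [0..<m]) / m - \<alpha>) * m"
        using m(3) by (simp add: deviation_def field_simps)
      then show ?thesis by (simp add: abs_mult)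
    qed
    also have "\<dots> \<le> \<epsilon> * m"
      using m by (intro mult_right_mono) auto
    finally have "map \<omega> [0..<m] \<in> good K"
      using m(2) \<omega>(1) by (simp add: good_def in_lists_conv_set del: One_nat_def atLeastAtMost_iff)
    then show "x \<in> (\<Union>w\<in>good K. inv_word w ` {0..1})"
      using \<omega>(2) by blast
  qed
  have term_le: "diameter (inv_word w ` {0..1}) powr s \<le> weight w * q ^ length w" if "w \<in> good K" for w K
  proof -
    have w: "w \<in> words" "\<bar>deviation w\<bar> \<le> \<epsilon> * length w" using that by (auto simp: good_def)
    have "diameter (inv_word w ` {0..1}) powr s \<le> exp (- log_slope w) powr s"
      using s w(1) by (intro powr_mono2 diameter_cylinder diameter_ge_0 bounded_cylinder) auto
    also have "\<dots> = exp (- s * (\<alpha> * length w + deviation w))"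
      by (simp add: powr_def deviation_def algebra_simps)
    also have "\<dots> \<le> exp (- (g * length w + c * deviation w) + - \<eta> * length w)"
    proof -
      have "(c - s) * deviation w \<le> \<bar>c - s\<bar> * \<bar>deviation w\<bar>"
        by (metis abs_ge_self abs_mult)
      also have "\<dots> \<le> (\<bar>c\<bar> + s) * \<bar>deviation w\<bar>"
        using s by (intro mult_right_mono) auto
      also have "\<dots> \<le> (\<bar>c\<bar> + s) * (\<epsilon> * length w)"
        using w(2) s by (intro mult_left_mono) auto
      also have "\<dots> \<le> \<eta> * length w"
        using \<epsilon>(3) by (simp add: mult_right_mono flip: mult.assoc)
      finally show ?thesis
        by (simp add: \<eta>_def field_simps)
    qed
    also have "\<dots> = weight w * q ^ length w"
      by (simp only: weight_def q_def exp_add exp_of_nat_mult[symmetric] mult.commute[of "- \<eta>"])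
    finally show ?thesis .
  qed
  have sum_le: "(\<Sum>w\<in>F. diameter (inv_word w ` {0..1}) powr s) \<le> q ^ K / (1 - q)"
    if F: "finite F" "F \<subseteq> good K" for F K
  proof -
    \<comment> \<open>Inserting \<open>K\<close> keeps the maximum meaningful for empty
      \<open>F\<close>.\<close>
    define M where "M = Max (insert K (length ` F))"
    have "(\<Sum>w\<in>F. diameter (inv_word w ` {0..1}) powr s) \<le> (\<Sum>w\<in>F. weight w * q ^ length w)"
      using term_le F by (intro sum_mono) blast
    also have "\<dots> = (\<Sum>m=K..M. \<Sum>w\<in>{w \<in> F. length w = m}. weight w * q ^ length w)"
      using F by (intro sum.group[symmetric]) (auto simp: M_def good_def)
    also have "\<dots> \<le> (\<Sum>m=K..M. \<Sum>w\<in>words_of m. weight w * q ^ m)"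
    proof (intro sum_mono)
      fix m
      have "(\<Sum>w\<in>{w \<in> F. length w = m}. weight w * q ^ length w)
          = (\<Sum>w\<in>{w \<in> F. length w = m}. weight w * q ^ m)"
        by simp
      also have "\<dots> \<le> (\<Sum>w\<in>words_of m. weight w * q ^ m)"
        using F q less_imp_le[OF weight_pos] finite_words_of
        by (intro sum_mono2) (auto simp: words_of_def good_def)
      finally show "(\<Sum>w\<in>{w \<in> F. length w = m}. weight w * q ^ length w)
          \<le> (\<Sum>w\<in>words_of m. weight w * q ^ m)" .
    qed
    also have "\<dots> = (\<Sum>m=K..M. q ^ m)"
      by (simp add: sum_weight flip: sum_distrib_right)
    also have "\<dots> \<le> q ^ K / (1 - q)"
      using q by (rule sum_geometric_tail_le)
    finally show ?thesis .
  qed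
  have "hausdorff_measure_delta s \<delta> level \<le> 0" if \<delta>: "0 < \<delta>" for \<delta>
  proof (rule ennreal_le_epsilon)
    fix e :: real assume e: "0 < e"
    have "(\<lambda>K. q ^ K / (1 - q)) \<longlonglongrightarrow> 0 / (1 - q)"
      using q by (intro tendsto_intros LIMSEQ_power_zero) auto
    then have "\<forall>\<^sub>F K in sequentially. q ^ K / (1 - q) < e"
      using e by (auto dest: order_tendstoD)
    moreover have "(\<lambda>K. exp (- \<alpha> / 2) ^ K) \<longlonglongrightarrow> 0"
      using exponent_pos by (intro LIMSEQ_power_zero) auto
    then have "\<forall>\<^sub>F K in sequentially. exp (- \<alpha> / 2) ^ K < \<delta>"
      using \<delta> by (auto dest: order_tendstoD)
    ultimately have "\<forall>\<^sub>F K in sequentially. q ^ K / (1 - q) < e \<and> exp (- \<alpha> / 2) ^ K < \<delta>"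
      by (rule eventually_conj)
    then obtain K where K: "q ^ K / (1 - q) < e" "exp (- \<alpha> / 2) ^ K < \<delta>"
      unfolding eventually_sequentially by blast
    have "hausdorff_measure_delta s \<delta> level \<le> ennreal (q ^ K / (1 - q))"
    proof (rule hausdorff_measure_delta_le[OF cover[of K]])
      fix w assume w: "w \<in> good K"
      then show "bounded (inv_word w ` {0..1})"
        by (intro bounded_cylinder) (auto simp: good_def)
      have "diameter (inv_word w ` {0..1}) \<le> exp (- log_slope w)"
        using w by (intro diameter_cylinder) (auto simp: good_def)
      also have "\<dots> \<le> exp (- \<alpha> / 2 * K)"
      proof -
        have "\<alpha> / 2 * K \<le> (\<alpha> - \<epsilon>) * length w"
          using w \<epsilon> exponent_pos by (intro mult_mono) (auto simp: good_def)
        also have "\<dots> \<le> log_slope w"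
          using w by (auto simp: good_def deviation_def algebra_simps abs_le_iff)
        finally show ?thesis by simp
      qed
      also have "\<dots> = exp (- \<alpha> / 2) ^ K"
        by (simp add: exp_of_nat_mult[symmetric] mult.commute)
      finally show "diameter (inv_word w ` {0..1}) \<le> \<delta>" using K(2) by simp
    next
      fix F assume "finite F" "F \<subseteq> good K"
      then show "(\<Sum>w\<in>F. diameter (inv_word w ` {0..1}) powr s) \<le> q ^ K / (1 - q)"
        by (rule sum_le)
    qed (use \<delta> in simp)
    also have "\<dots> \<le> ennreal e" using K(1) by (intro ennreal_leI) simp
    finally show "hausdorff_measure_delta s \<delta> level \<le> 0 + ennreal e" by simp
  qed
  then show ?thesis
    by (auto simp: hausdorff_measure_def intro!: antisym SUP_least)
qed

section \<open>Lower bound for the dimension of a level set\<close>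

text \<open>\<open>sqrt (2 * variance)\<close> is the Chebyshev constant for mass 1/2; adding 1
  keeps it positive when the variance vanishes.\<close>

definition spread :: real where
  "spread = sqrt (2 * variance) + 1"

definition typical :: "nat \<Rightarrow> nat list set" where
  "typical j = {w \<in> words_of j. \<bar>deviation w\<bar> \<le> spread * sqrt j}"

lemma variance_nonneg: "0 \<le> variance"
  by (auto simp: variance_def intro!: sum_nonneg)

lemma spread_pos: "0 < spread"
  using variance_nonneg by (simp add: spread_def add_nonneg_pos)

lemma spread_sq: "2 * variance \<le> spread\<^sup>2"
proof -
  have "2 * variance = (sqrt (2 * variance))\<^sup>2"
    using variance_nonneg by simp
  also have "\<dots> \<le> spread\<^sup>2"
    unfolding spread_def using variance_nonneg by (intro power_mono) auto
  finally show ?thesis .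
qed

lemma finite_typical: "finite (typical j)"
  using finite_words_of by (simp add: typical_def)

text \<open>Chebyshev's inequality: the other words have total weight at most
  \<open>variance / spread\<^sup>2\<close>.\<close>

lemma weight_typical: "1 / 2 \<le> (\<Sum>w\<in>typical j. weight w)"
proof (cases "j = 0")
  case True
  then have "typical j = {[]}"
    by (auto simp: typical_def words_of_0)
  then show ?thesis by simp
next
  case False
  define A where "A = words_of j - typical j"
  have "spread\<^sup>2 * j * (\<Sum>w\<in>A. weight w) = (\<Sum>w\<in>A. weight w * (spread * sqrt j)\<^sup>2)"
    by (simp add: power_mult_distrib mult.commute flip: sum_distrib_right)
  also have "\<dots> \<le> (\<Sum>w\<in>A. weight w * (deviation w)\<^sup>2)"
  proof (intro sum_mono mult_left_mono)
    fix w assume "w \<in> A"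
    then have "spread * sqrt j \<le> \<bar>deviation w\<bar>"
      by (auto simp: A_def typical_def)
    then show "(spread * sqrt j)\<^sup>2 \<le> (deviation w)\<^sup>2"
      using spread_pos power_mono[of "spread * sqrt j" "\<bar>deviation w\<bar>" 2] by simp
  qed (simp add: weight_pos less_imp_le)
  also have "\<dots> \<le> (\<Sum>w\<in>words_of j. weight w * (deviation w)\<^sup>2)"
    by (intro sum_mono2) (auto simp: A_def finite_words_of weight_pos less_imp_le)
  also have "\<dots> \<le> j * (spread\<^sup>2 / 2)"
    unfolding sum_weight_deviation_sq using spread_sq by (intro mult_left_mono) auto
  also have "\<dots> = spread\<^sup>2 * j * (1 / 2)" by simp
  finally have "(\<Sum>w\<in>A. weight w) \<le> 1 / 2"
    using False spread_pos by (subst (asm) mult_le_cancel_left_pos) auto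
  moreover have "(\<Sum>w\<in>A. weight w) + (\<Sum>w\<in>typical j. weight w) = 1"
    unfolding A_def sum_weight[of j, symmetric]
    by (rule sum.subset_diff[symmetric]) (auto simp: typical_def finite_words_of)
  ultimately show ?thesis by simp
qed

text \<open>Every typical word has weight at most
  \<open>exp (- (g * j - \<bar>c\<bar> * spread * sqrt j))\<close>; their total of at least 1/2
  accounts for \<open>ln 2\<close>.\<close>

lemma card_typical: "exp (g * j - \<bar>c\<bar> * spread * sqrt j - ln 2) \<le> card (typical j)"
proof -
  define B where "B = g * j - \<bar>c\<bar> * spread * sqrt j"
  have "1 / 2 \<le> (\<Sum>w\<in>typical j. weight w)" by (rule weight_typical)
  also have "\<dots> \<le> (\<Sum>w\<in>typical j. exp (- B))"
  proof (rule sum_mono)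
    fix w assume w: "w \<in> typical j"
    have "- (c * deviation w) \<le> \<bar>c\<bar> * \<bar>deviation w\<bar>"
      by (metis abs_ge_minus_self abs_mult)
    also have "\<dots> \<le> \<bar>c\<bar> * (spread * sqrt j)"
      using w by (intro mult_left_mono) (auto simp: typical_def)
    finally show "weight w \<le> exp (- B)"
      using w by (simp add: weight_def B_def typical_def words_of_def mult.assoc)
  qed
  also have "\<dots> = card (typical j) * exp (- B)" by simp
  finally have "exp B / 2 \<le> card (typical j)"
    by (simp add: exp_minus field_simps)
  then show ?thesis
    by (simp add: B_def exp_diff)
qed

lemma card_typical_pos: "0 < card (typical j)"
  using card_typical[of j] by (metis exp_gt_zero less_le_trans of_nat_0_less_iff)

text \<open>A crude linear bound, for the incomplete last block of a prefix.\<close>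

lemma deviation_le_length:
  "w \<in> words \<Longrightarrow> \<bar>deviation w\<bar> \<le> (\<Sum>i=1..n. \<bar>ln (pl_slope l r i) - \<alpha>\<bar>) * length w"
proof (induction w)
  case (Cons i w)
  have "\<bar>ln (pl_slope l r i) - \<alpha>\<bar> \<le> (\<Sum>i=1..n. \<bar>ln (pl_slope l r i) - \<alpha>\<bar>)"
    using Cons.prems by (intro member_le_sum[of i "{1..n}" "\<lambda>i. \<bar>ln (pl_slope l r i) - \<alpha>\<bar>"]) auto
  then show ?case
    using Cons by (simp add: algebra_simps)
qed simp

end

text \<open>In mixed radix notation, division by the last base recovers the cell index one level
  up.\<close>

lemma nat_floor_mult_div:
  fixes x :: real
  assumes "0 \<le> x" "0 < N"
  shows "nat \<lfloor>x * real N\<rfloor> div N = nat \<lfloor>x\<rfloor>"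
proof -
  have "\<lfloor>x * real N / real_of_int (int N)\<rfloor> = \<lfloor>x * real N\<rfloor> div int N"
    by (rule floor_divide_real_eq_div) simp
  then have "\<lfloor>x\<rfloor> = \<lfloor>x * real N\<rfloor> div int N"
    using assms(2) by simp
  then show ?thesis
    using assms(1) by (simp add: nat_div_distrib)
qed

lemma exp_neg_quadratic_tendsto_0:
  fixes a x y z :: real
  assumes "0 < a"
  shows "(\<lambda>J. exp (- (a * real J * real J) + x * J + y * (J * sqrt J) + z * sqrt J)) \<longlonglongrightarrow> 0"
proof (rule Lim_null_comparison)
  \<comment> \<open>\<open>M\<close> replaces three coefficients of unknown sign: for
    \<open>J\<close> at least 1, all lower-order terms are dominated by multiples of
    \<open>J * sqrt J\<close>.\<close>
  define M where "M = \<bar>x\<bar> + \<bar>y\<bar> + \<bar>z\<bar> + 1"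
  have "0 < M" by (simp add: M_def add_nonneg_pos)
  with assms show "(\<lambda>J. exp (- (a * real J * real J) + M * (J * sqrt J))) \<longlonglongrightarrow> 0"
    by real_asymp
  show "\<forall>\<^sub>F J in sequentially. norm (exp (- (a * real J * real J) + x * J + y * (J * sqrt J) + z * sqrt J))
      \<le> exp (- (a * real J * real J) + M * (J * sqrt J))"
    using eventually_ge_at_top[of 1]
  proof eventually_elim
    case (elim J)
    define q where "q = real J * sqrt J"
    have "1 \<le> sqrt J" "1 \<le> real J" using elim by simp_all
    then have "real J * 1 \<le> q" "1 * sqrt J \<le> q"
      unfolding q_def by (auto intro!: mult_mono)
    then have "x * J \<le> \<bar>x\<bar> * q" "z * sqrt J \<le> \<bar>z\<bar> * q" "y * q \<le> \<bar>y\<bar> * q" "0 \<le> q"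
      by (auto intro!: mult_mono mult_right_mono simp: q_def)
    then show ?case
      by (simp add: M_def q_def[symmetric] algebra_simps)
  qed
qed

text \<open>
  A point is attached to every \<open>t \<in> [0, 1)\<close> by expanding \<open>t\<close> in the mixed radix system with bases
  \<open>card (typical j)\<close> and letting the \<open>j\<close>-th digit choose a typical word of length \<open>j\<close>. The words grow
  in order to force convergence of the exponents, but so slowly that a single word is negligible
  compared to its predecessors. The pad \<open>v\<close> after every word keeps the points away from the endpoints
  of cylinders; this separates different points and makes all iterates differentiable.
\<close>

locale moran_construction = gibbs_weights +
  fixes v :: "nat list" and \<delta> :: real
  assumes pad_word: "v \<in> words" "v \<noteq> []"
    and \<delta>_pos: "0 < \<delta>"
    and pad_inner: "y \<in> {0..1} \<Longrightarrow> inv_word v y \<in> {\<delta>..1 - \<delta>}"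
begin

definition typical_word :: "nat \<Rightarrow> nat \<Rightarrow> nat list" where
  "typical_word j = (SOME f. bij_betw f {0..<card (typical j)} (typical j))"

definition cells :: "nat \<Rightarrow> nat" where
  "cells J = (\<Prod>j<J. card (typical j))"

definition cell :: "nat \<Rightarrow> real \<Rightarrow> nat" where
  "cell J t = nat \<lfloor>t * cells J\<rfloor>"

text \<open>The last mixed-radix digit of the index of the cell of level \<open>Suc j\<close> that
  contains \<open>t\<close>.\<close>

definition digit :: "real \<Rightarrow> nat \<Rightarrow> nat" where
  "digit t j = cell (Suc j) t mod card (typical j)"

definition digit_word :: "real \<Rightarrow> nat \<Rightarrow> nat list" where
  "digit_word t j = typical_word j (digit t j)"

definition address :: "real \<Rightarrow> nat \<Rightarrow> nat list" where
  "address t J = concat (map (\<lambda>j. digit_word t j @ v) [0..<J])"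

text \<open>Chosen in the intersection of nested cylinders; all later estimates rest on membership
  in every one of them.\<close>

definition point :: "real \<Rightarrow> real" where
  "point t = (SOME x. \<forall>J. x \<in> inv_word (address t J) ` {0..1})"

lemma typical_word_bij: "bij_betw (typical_word j) {0..<card (typical j)} (typical j)"
  using someI_ex[OF ex_bij_betw_nat_finite[OF finite_typical]] unfolding typical_word_def .

lemma digit_less: "digit t j < card (typical j)"
  using card_typical_pos by (simp add: digit_def)

lemma digit_word_typical: "digit_word t j \<in> typical j"
  using bij_betw_apply[OF typical_word_bij] digit_less by (simp add: digit_word_def)

lemma digit_word_facts:
  "digit_word t j \<in> words" "length (digit_word t j) = j"
  "\<bar>deviation (digit_word t j)\<bar> \<le> spread * sqrt j"
  using digit_word_typical[of t j] by (auto simp: typical_def words_of_def)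

lemma digit_word_eq: "digit_word t j = digit_word t' j \<Longrightarrow> digit t j = digit t' j"
  using bij_betw_imp_inj_on[OF typical_word_bij, of j] digit_less[of t j] digit_less[of t' j]
  unfolding digit_word_def by (auto dest: inj_onD)

lemma cells_pos: "0 < cells J"
  using card_typical_pos by (simp add: cells_def prod_pos)

text \<open>The index at level \<open>Suc J\<close> is the index at level \<open>J\<close> times the
  base, plus digit \<open>J\<close>; at level 0 it is 0 because \<open>t < 1\<close>.\<close>

lemma cell_eq_if_digits_eq:
  assumes "t \<in> {0..<1}" "t' \<in> {0..<1}" "\<And>j. j < J \<Longrightarrow> digit t j = digit t' j"
  shows "cell J t = cell J t'"
  using assms(3)
proof (induction J)
  case 0
  then show ?case
    using assms(1,2) by (simp add: cell_def cells_def floor_eq_iff)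
next
  case (Suc J)
  have "cell (Suc J) t div card (typical J) = cell J t" if "t \<in> {0..<1}" for t
  proof -
    have "0 \<le> t * cells J" using that by simp
    from nat_floor_mult_div[OF this card_typical_pos[of J]] show ?thesis
      by (simp add: cell_def cells_def mult.assoc)
  qed
  then have "cell (Suc J) t div card (typical J) = cell (Suc J) t' div card (typical J)"
    using Suc assms(1,2) by simp
  moreover have "cell (Suc J) t mod card (typical J) = cell (Suc J) t' mod card (typical J)"
    using Suc.prems[of J] by (simp add: digit_def)
  ultimately show ?case
    by (metis div_mult_mod_eq)
qed

lemma dist_le_if_digits_eq:
  assumes "t \<in> {0..<1}" "t' \<in> {0..<1}" "\<And>j. j < J \<Longrightarrow> digit t j = digit t' j"
  shows "\<bar>t - t'\<bar> \<le> 1 / cells J"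
proof -
  have "cell J t = cell J t'"
    by (rule cell_eq_if_digits_eq) (use assms in auto)
  moreover have "0 \<le> t * cells J" "0 \<le> t' * cells J"
    using assms(1,2) by auto
  ultimately have "\<lfloor>t * cells J\<rfloor> = \<lfloor>t' * cells J\<rfloor>"
    unfolding cell_def zero_le_floor[symmetric] by (simp only: eq_nat_nat_iff)
  then have "\<bar>t * cells J - t' * cells J\<bar> \<le> 1"
    by linarith
  then have "\<bar>t - t'\<bar> * cells J \<le> 1"
    by (simp add: abs_mult flip: left_diff_distrib)
  then show ?thesis
    using cells_pos[of J] by (simp add: field_simps)
qed

lemma address_simps [simp]:
  "address t 0 = []"
  "address t (Suc J) = address t J @ digit_word t J @ v"
  by (simp_all add: address_def)

lemma address_words: "address t J \<in> words"
  by (induction J) (use digit_word_facts pad_word in auto)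

lemma length_address: "real (length (address t J)) = (real J * real J - real J) / 2 + real J * length v"
  by (induction J) (use digit_word_facts in \<open>auto simp: algebra_simps add_divide_distrib diff_divide_distrib\<close>)

text \<open>The words of lengths 0 to \<open>J - 1\<close> have \<open>(J\<^sup>2 - J) / 2\<close>
  letters in total; the nonempty pads supply the missing \<open>J / 2\<close>, and a letter even for
  the block whose word is empty.\<close>

lemma length_address_ge: "(real J)\<^sup>2 / 2 \<le> length (address t J)" "J \<le> length (address t J)"
proof -
  have v: "1 \<le> length v" using pad_word by (cases v) auto
  then have "real J * 1 \<le> real J * length v"
    by (intro mult_left_mono) auto
  then show "(real J)\<^sup>2 / 2 \<le> length (address t J)"
    by (simp add: length_address power2_eq_square diff_divide_distrib)
  show "J \<le> length (address t J)"
    using v by (induction J) (auto simp: digit_word_facts)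
qed

text \<open>Of order \<open>J * sqrt J\<close>, hence negligible against the quadratic length of the
  address.\<close>

lemma deviation_address: "\<bar>deviation (address t J)\<bar> \<le> J * (spread * sqrt J + \<bar>deviation v\<bar>)"
proof (induction J)
  case (Suc J)
  have "\<bar>deviation (address t (Suc J))\<bar>
      \<le> \<bar>deviation (address t J)\<bar> + \<bar>deviation (digit_word t J)\<bar> + \<bar>deviation v\<bar>"
    by simp
  also have "\<dots> \<le> J * (spread * sqrt J + \<bar>deviation v\<bar>) + spread * sqrt J + \<bar>deviation v\<bar>"
    using Suc digit_word_facts(3)[of t J] by simp
  also have "\<dots> = Suc J * (spread * sqrt J + \<bar>deviation v\<bar>)"
    by (simp add: algebra_simps)
  also have "\<dots> \<le> Suc J * (spread * sqrt (Suc J) + \<bar>deviation v\<bar>)"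
    using spread_pos by (intro mult_left_mono add_right_mono) auto
  finally show ?case .
qed simp

lemma ex_point: "\<exists>x. \<forall>J. x \<in> inv_word (address t J) ` {0..1}"
proof -
  have "\<Inter>(range (\<lambda>J. inv_word (address t J) ` {0..1})) \<noteq> {}"
  proof (rule compact_nest)
    fix J
    have "continuous_on {0..1} (\<lambda>y. inv_word (address t J) 0
        + word_sign (address t J) * exp (- log_slope (address t J)) * y)"
      by (intro continuous_intros)
    then have "continuous_on {0..1} (inv_word (address t J))"
      by (subst continuous_on_cong[OF refl inv_word_affine[OF address_words]])
    then show "compact (inv_word (address t J) ` {0..1})"
      by (rule compact_continuous_image) simp
    show "inv_word (address t J) ` {0..1} \<noteq> {}" by simp
  next
    have "decseq (\<lambda>J. inv_word (address t J) ` {0..1})"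
    proof (rule decseq_SucI)
      fix J
      show "inv_word (address t (Suc J)) ` {0..1} \<subseteq> inv_word (address t J) ` {0..1}"
      proof
        fix x assume "x \<in> inv_word (address t (Suc J)) ` {0..1}"
        then obtain y where y: "y \<in> {0..1}" "x = inv_word (address t J) (inv_word (digit_word t J @ v) y)"
          by auto
        moreover have "inv_word (digit_word t J @ v) y \<in> {0..1}"
          by (rule inv_word_closed) (use y digit_word_facts pad_word in auto)
        ultimately show "x \<in> inv_word (address t J) ` {0..1}" by blast
      qed
    qed
    then show "m \<le> k \<Longrightarrow> inv_word (address t k) ` {0..1} \<subseteq> inv_word (address t m) ` {0..1}" for m k
      by (simp add: decseq_def)
  qed
  then show ?thesis by auto
qed

text \<open>The pad follows \<open>digit_word t J\<close>, so it keeps the remaining point at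
  distance at least \<delta> from 0 and 1.\<close>

lemma point_inner:
  obtains z where "z \<in> {\<delta>..1 - \<delta>}" "point t = inv_word (address t J @ digit_word t J) z"
proof -
  have "point t \<in> inv_word (address t (Suc J)) ` {0..1}"
    using someI_ex[OF ex_point[of t]] unfolding point_def by blast
  then obtain y where "y \<in> {0..1}" "point t = inv_word (address t (Suc J)) y" by blast
  then show ?thesis
    using pad_inner[of y] that[of "inv_word v y"] by simp
qed

lemma point_address_open: "point t \<in> inv_word (address t J) ` {0<..<1}"
proof -
  obtain z where z: "z \<in> {\<delta>..1 - \<delta>}" "point t = inv_word (address t J @ digit_word t J) z"
    by (rule point_inner)
  then have "inv_word (digit_word t J) z \<in> {0<..<1}"
    using \<delta>_pos digit_word_facts by (intro inv_word_open) auto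
  then show ?thesis using z(2) by auto
qed

lemma take_address:
  assumes "m \<le> length (address t J)"
  shows "\<exists>K u. take m (address t J) = address t K @ u \<and> u \<in> words \<and> length u \<le> K + length v
           \<and> length (address t K) \<le> m"
  using assms
proof (induction J)
  case 0
  then show ?case by (intro exI[of _ 0] exI[of _ "[]"]) auto
next
  case (Suc J)
  show ?case
  proof (cases "m \<le> length (address t J)")
    case True
    then show ?thesis using Suc.IH by simp
  next
    case False
    define u where "u = take (m - length (address t J)) (digit_word t J @ v)"
    have "u \<in> words"
      unfolding u_def using digit_word_facts pad_word by (intro words_take) auto
    moreover have "length u \<le> J + length v"
      by (simp add: u_def digit_word_facts)
    moreover have "take m (address t (Suc J)) = address t J @ u"
      using False by (simp add: u_def)
    ultimately show ?thesis
      using False by (intro exI[of _ J] exI[of _ u]) simp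
  qed
qed

text \<open>A prefix consists of \<open>K\<close> complete blocks and part of another;
  \<open>K\<^sup>2 / 2\<close> is at most \<open>m\<close>, so \<open>K\<close> is at most
  \<open>q\<close>. The bound has order \<open>m powr (3/4)\<close>, which is sublinear.\<close>

lemma deviation_take_address:
  assumes "m \<le> length (address t J)"
  defines "q \<equiv> sqrt (2 * real m)"
  shows "\<bar>deviation (take m (address t J))\<bar> \<le> q * (spread * sqrt q + \<bar>deviation v\<bar>)
           + (\<Sum>i=1..n. \<bar>ln (pl_slope l r i) - \<alpha>\<bar>) * (q + length v)"
proof -
  define M where "M = (\<Sum>i=1..n. \<bar>ln (pl_slope l r i) - \<alpha>\<bar>)"
  have M: "0 \<le> M" by (auto simp: M_def intro!: sum_nonneg)
  obtain K u where u: "take m (address t J) = address t K @ u" "u \<in> words" "length u \<le> K + length v"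
      "length (address t K) \<le> m"
    using take_address[OF assms(1)] by blast
  have "(real K)\<^sup>2 / 2 \<le> m"
    using length_address_ge(1)[of K t] u(4) by linarith
  then have K: "real K \<le> q"
    unfolding q_def by (intro real_le_rsqrt) simp
  have "\<bar>deviation (take m (address t J))\<bar> \<le> \<bar>deviation (address t K)\<bar> + \<bar>deviation u\<bar>"
    using u(1) by simp
  also have "\<dots> \<le> K * (spread * sqrt K + \<bar>deviation v\<bar>) + M * (K + length v)"
  proof (rule add_mono[OF deviation_address])
    have "\<bar>deviation u\<bar> \<le> M * length u"
      unfolding M_def by (rule deviation_le_length[OF u(2)])
    also have "\<dots> \<le> M * (K + length v)"
      using u(3) M by (intro mult_left_mono) auto
    finally show "\<bar>deviation u\<bar> \<le> M * (K + length v)" by simp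
  qed
  also have "\<dots> \<le> q * (spread * sqrt q + \<bar>deviation v\<bar>) + M * (q + length v)"
    using K M spread_pos by (intro add_mono mult_mono mult_left_mono) (auto simp: q_def)
  finally show ?thesis by (simp add: M_def)
qed

lemma point_level: "point t \<in> level"
proof -
  \<comment> \<open>\<open>address t m\<close> has at least \<open>m\<close> letters, so
    \<open>W m\<close> is a prefix of length exactly \<open>m\<close>.\<close>
  define W where "W = (\<lambda>m. take m (address t m))"
  have W: "W m \<in> words" "length (W m) = m" for m
    unfolding W_def using words_take[OF address_words] length_address_ge(2)[of m t] by simp_all
  have open_W: "point t \<in> inv_word (W m) ` {0<..<1}" for m
  proof -
    obtain y where y: "y \<in> {0<..<1}" "point t = inv_word (address t m) y"
      using point_address_open by blast
    then have "point t = inv_word (W m) (inv_word (drop m (address t m)) y)"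
      unfolding W_def by (metis append_take_drop_id inv_word_simps(3))
    moreover have "inv_word (drop m (address t m)) y \<in> {0<..<1}"
      by (rule inv_word_open[OF words_drop[OF address_words] y(1)])
    ultimately show ?thesis by blast
  qed
  have "(T ^^ k) (point t) \<in> pl_domain n l r" for k
  proof -
    have "point t \<in> iterate_domain n l r T (Suc k)"
      using inv_word_iterate_domain[OF W(1), of _ "Suc k"] open_W[of "Suc k"] W(2) by auto
    then show ?thesis by (simp add: iterate_domain_def)
  qed
  then have "point t \<in> repeller n l r T"
    by (simp add: repeller_def)
  moreover have "has_lyapunov_exponent n l r T (point t) \<alpha>"
    unfolding has_lyapunov_exponent_def
  proof (intro exI[of _ "\<lambda>m. word_sign (W m) * exp (log_slope (W m))"] conjI allI)
    fix m
    show "((T ^^ m) has_real_derivative word_sign (W m) * exp (log_slope (W m)))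
        (at (point t) within iterate_domain n l r T m)"
      using T_funpow_deriv[OF W(1) open_W, of m] W(2) by (simp add: has_field_derivative_at_within)
  next
    define M where "M = (\<Sum>i=1..n. \<bar>ln (pl_slope l r i) - \<alpha>\<bar>)"
    define b where "b = (\<lambda>m. (sqrt (2 * real m) * (spread * sqrt (sqrt (2 * real m)) + \<bar>deviation v\<bar>)
           + M * (sqrt (2 * real m) + length v)) / m)"
    have "b \<longlonglongrightarrow> 0"
    proof -
      define d e where "d = \<bar>deviation v\<bar> + M" and "e = M * length v"
      have "b = (\<lambda>m. spread * (sqrt (2 * real m) * sqrt (sqrt (2 * real m)) / m)
          + d * (sqrt (2 * real m) / m) + e * (1 / m))"
        by (simp add: b_def d_def e_def add_divide_distrib distrib_left distrib_right mult_ac add_ac)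
      moreover have "(\<lambda>m. spread * (sqrt (2 * real m) * sqrt (sqrt (2 * real m)) / m)
          + d * (sqrt (2 * real m) / m) + e * (1 / m)) \<longlonglongrightarrow> spread * 0 + d * 0 + e * 0"
      proof (intro tendsto_add tendsto_mult_left)
        show "(\<lambda>m. sqrt (2 * real m) * sqrt (sqrt (2 * real m)) / m) \<longlonglongrightarrow> 0"
          by real_asymp
        show "(\<lambda>m. sqrt (2 * real m) / m) \<longlonglongrightarrow> 0"
          by real_asymp
        show "(\<lambda>m. 1 / real m) \<longlonglongrightarrow> 0"
          by real_asymp
      qed
      ultimately show ?thesis by (simp only:) simp
    qed
    moreover have "\<forall>\<^sub>F m in sequentially. norm (1 / m * ln \<bar>word_sign (W m) * exp (log_slope (W m))\<bar> - \<alpha>) \<le> b m"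
      using eventually_gt_at_top[of 0]
    proof eventually_elim
      case (elim m)
      have "1 / m * ln \<bar>word_sign (W m) * exp (log_slope (W m))\<bar> - \<alpha> = deviation (W m) / m"
        using elim W(2)[of m] by (simp add: abs_mult deviation_def field_simps)
      moreover have "\<bar>deviation (W m)\<bar> / m \<le> b m"
        unfolding b_def W_def M_def
        by (rule divide_right_mono[OF deviation_take_address[OF length_address_ge(2)]]) simp
      ultimately show ?case by simp
    qed
    ultimately have "(\<lambda>m. 1 / m * ln \<bar>word_sign (W m) * exp (log_slope (W m))\<bar> - \<alpha>) \<longlonglongrightarrow> 0"
      by (rule Lim_null_comparison[rotated])
    then show "(\<lambda>m. 1 / m * ln \<bar>word_sign (W m) * exp (log_slope (W m))\<bar>) \<longlonglongrightarrow> \<alpha>"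
      by (simp add: LIM_zero_iff)
  qed
  ultimately show ?thesis by (simp add: level_def)
qed

section \<open>Hoelder estimate for the inverse of the point map\<close>

definition log_cells_bound :: "nat \<Rightarrow> real" where
  "log_cells_bound J = g * (real J * real J - real J) / 2 - J * (\<bar>c\<bar> * spread * sqrt J + ln 2)"

text \<open>\<alpha> times the length of \<open>address t J @ digit_word t J\<close>, plus bounds
  for the deviations of both words.\<close>

definition log_slope_bound :: "nat \<Rightarrow> real" where
  "log_slope_bound J = \<alpha> * ((real J * real J - real J) / 2 + real J * length v + J)
     + J * (spread * sqrt J + \<bar>deviation v\<bar>) + spread * sqrt J"

text \<open>The exponents of \<open>card_typical\<close> are summed over \<open>j < J\<close>, with
  \<open>sqrt j\<close> enlarged to \<open>sqrt J\<close>.\<close>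

lemma cells_ge: "exp (log_cells_bound J) \<le> cells J"
proof (induction J)
  case 0
  then show ?case by (simp add: log_cells_bound_def cells_def)
next
  case (Suc J)
  have "J * (\<bar>c\<bar> * spread * sqrt J + ln 2) + (\<bar>c\<bar> * spread * sqrt J + ln 2)
      = Suc J * (\<bar>c\<bar> * spread * sqrt J + ln 2)"
    by (simp add: algebra_simps)
  also have "\<dots> \<le> Suc J * (\<bar>c\<bar> * spread * sqrt (Suc J) + ln 2)"
    using spread_pos by (intro mult_left_mono add_right_mono) auto
  finally have "log_cells_bound (Suc J) \<le> log_cells_bound J + (g * J - \<bar>c\<bar> * spread * sqrt J - ln 2)"
    by (simp add: log_cells_bound_def field_simps)
  then have "exp (log_cells_bound (Suc J)) \<le> exp (log_cells_bound J) * exp (g * J - \<bar>c\<bar> * spread * sqrt J - ln 2)"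
    by (simp add: exp_add[symmetric])
  also have "\<dots> \<le> cells J * card (typical J)"
    using Suc card_typical[of J] unfolding of_nat_mult by (intro mult_mono) auto
  finally show ?case by (simp add: cells_def)
qed

lemma log_slope_le: "log_slope (address t J @ digit_word t J) \<le> log_slope_bound J"
proof -
  have "log_slope (address t J @ digit_word t J) = \<alpha> * length (address t J @ digit_word t J)
      + deviation (address t J) + deviation (digit_word t J)"
    by (simp add: deviation_def algebra_simps)
  then show ?thesis
    using deviation_address[of t J] digit_word_facts[of t J]
    by (simp add: log_slope_bound_def length_address)
qed

lemma point_separated:
  assumes "\<And>j. j < J \<Longrightarrow> digit t j = digit t' j" "digit t J \<noteq> digit t' J"
  shows "\<delta> * exp (- log_slope_bound J) \<le> \<bar>point t - point t'\<bar>"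
proof -
  have addr: "address t J = address t' J"
    using assms(1) by (auto simp: address_def digit_word_def intro!: arg_cong[of _ _ concat])
  obtain z where z: "z \<in> {\<delta>..1 - \<delta>}" "point t = inv_word (address t J @ digit_word t J) z"
    by (rule point_inner)
  obtain z' where z': "z' \<in> {\<delta>..1 - \<delta>}" "point t' = inv_word (address t' J @ digit_word t' J) z'"
    by (rule point_inner)
  have "\<delta> * exp (- log_slope (address t J @ digit_word t J)) \<le> \<bar>point t - point t'\<bar>"
    unfolding z(2) z'(2)
  proof (rule inv_word_separated[OF _ _ _ _ z(1) z'(1) \<delta>_pos])
    show "address t J @ digit_word t J \<in> words" "address t' J @ digit_word t' J \<in> words"
      using address_words digit_word_facts(1) by simp_all
    show "length (address t J @ digit_word t J) = length (address t' J @ digit_word t' J)"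
      using addr by (simp add: digit_word_facts(2))
    show "address t J @ digit_word t J \<noteq> address t' J @ digit_word t' J"
      unfolding addr using assms(2) digit_word_eq[of t J t'] by auto
  qed
  moreover have "exp (- log_slope_bound J) \<le> exp (- log_slope (address t J @ digit_word t J))"
    using log_slope_le[of t J] by simp
  ultimately show ?thesis
    using \<delta>_pos by (meson mult_le_cancel_left_pos order_trans)
qed

text \<open>If \<open>J\<close> is the first differing digit, the parameters are within
  \<open>exp (- log_cells_bound J)\<close> and the points at least
  \<open>\<delta> * exp (- log_slope_bound J)\<close> apart. The exponents have leading terms
  \<open>g * J\<^sup>2 / 2\<close> and \<open>\<alpha> * J\<^sup>2 / 2\<close>, so
  \<open>s * \<alpha> < g\<close> keeps the quotient bounded.\<close>

lemma point_expanding: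
  assumes s: "0 < s" "s * \<alpha> < g"
  obtains C where "0 < C"
    "\<And>t t'. t \<in> {0..<1} \<Longrightarrow> t' \<in> {0..<1} \<Longrightarrow> \<bar>t - t'\<bar> \<le> C * \<bar>point t - point t'\<bar> powr s"
proof -
  have g: "0 < g" using s exponent_pos by (meson less_trans mult_pos_pos)
  have "(\<lambda>J. exp (- (g / 2 * real J * real J) + (g / 2 + ln 2) * J
      + \<bar>c\<bar> * spread * (J * sqrt J) + 0 * sqrt J)) \<longlonglongrightarrow> 0"
    using g by (intro exp_neg_quadratic_tendsto_0) simp
  then have lim0: "(\<lambda>J. exp (- log_cells_bound J)) \<longlonglongrightarrow> 0"
    by (rule Lim_transform_eventually) (simp add: log_cells_bound_def field_simps)
  have "(\<lambda>J. exp (- ((g - s * \<alpha>) / 2 * real J * real J)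
      + (s * \<alpha> * (length v + 1 / 2) + s * \<bar>deviation v\<bar> + g / 2 + ln 2) * J
      + (s + \<bar>c\<bar>) * spread * (J * sqrt J) + s * spread * sqrt J)) \<longlonglongrightarrow> 0"
    using s by (intro exp_neg_quadratic_tendsto_0) simp
  then have "(\<lambda>J. exp (s * log_slope_bound J - log_cells_bound J)) \<longlonglongrightarrow> 0"
    by (rule Lim_transform_eventually)
      (simp add: log_cells_bound_def log_slope_bound_def field_simps)
  then have "Bseq (\<lambda>J. exp (s * log_slope_bound J - log_cells_bound J))"
    by (intro convergent_imp_Bseq convergentI)
  then obtain B where B: "0 < B" "\<And>J. exp (s * log_slope_bound J - log_cells_bound J) \<le> B"
    by (auto simp: Bseq_def)
  have "\<bar>t - t'\<bar> \<le> B / \<delta> powr s * \<bar>point t - point t'\<bar> powr s"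
    if t: "t \<in> {0..<1}" "t' \<in> {0..<1}" for t t'
  proof (cases "\<forall>j. digit t j = digit t' j")
    case True
    \<comment> \<open>Parameters with equal digits share the cells of all levels and hence
      coincide.\<close>
    have "\<bar>t - t'\<bar> \<le> exp (- log_cells_bound J)" for J
    proof -
      have "\<bar>t - t'\<bar> \<le> 1 / cells J"
        using dist_le_if_digits_eq[OF t] True by simp
      also have "\<dots> \<le> 1 / exp (log_cells_bound J)"
        using cells_ge cells_pos[of J] by (intro divide_left_mono) auto
      finally show ?thesis by (simp add: exp_minus field_simps)
    qed
    then have "\<bar>t - t'\<bar> \<le> 0"
      by (intro LIMSEQ_le_const[OF lim0]) auto
    then show ?thesis using B by simp
  next
    case False
    define J where "J = (LEAST j. digit t j \<noteq> digit t' j)"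
    have J: "digit t J \<noteq> digit t' J" "\<And>j. j < J \<Longrightarrow> digit t j = digit t' j"
      using False LeastI_ex[of "\<lambda>j. digit t j \<noteq> digit t' j"] not_less_Least
      by (auto simp: J_def)
    have "\<bar>t - t'\<bar> \<le> 1 / cells J"
      using dist_le_if_digits_eq[OF t J(2)] .
    also have "\<dots> \<le> 1 / exp (log_cells_bound J)"
      using cells_ge cells_pos[of J] by (intro divide_left_mono) auto
    also have "\<dots> = exp (s * log_slope_bound J - log_cells_bound J) * exp (- s * log_slope_bound J)"
      by (simp add: exp_add[symmetric] exp_minus field_simps)
    also have "\<dots> \<le> B * exp (- s * log_slope_bound J)"
      using B by (intro mult_right_mono) auto
    also have "\<dots> = B / \<delta> powr s * (\<delta> * exp (- log_slope_bound J)) powr s"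
    proof -
      have "exp (- log_slope_bound J) powr s = exp (- s * log_slope_bound J)"
        by (simp add: powr_def)
      then show ?thesis using \<delta>_pos by (simp add: powr_mult)
    qed
    also have "\<dots> \<le> B / \<delta> powr s * \<bar>point t - point t'\<bar> powr s"
      using point_separated[OF J(2,1)] \<delta>_pos B s
      by (intro mult_left_mono powr_mono2) auto
    finally show ?thesis .
  qed
  moreover have "0 < B / \<delta> powr s" using B \<delta>_pos by simp
  ultimately show ?thesis using that by blast
qed

end

context gibbs_weights
begin

lemma hausdorff_measure_level_nonzero:
  assumes "0 < s" "s * \<alpha> < g"
  shows "hausdorff_measure s level \<noteq> 0"
proof -
  obtain v \<delta> where v: "v \<in> words" "v \<noteq> []" "0 < \<delta>"
    "\<And>y. y \<in> {0..1} \<Longrightarrow> inv_word v y \<in> {\<delta>..1 - \<delta>}"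
    using inner_cylinder_exists[OF two_branches] by metis
  interpret moran_construction n l r T orient \<alpha> c g v \<delta>
    by unfold_locales (use v in auto)
  obtain C where "0 < C"
    "\<And>t t'. t \<in> {0..<1} \<Longrightarrow> t' \<in> {0..<1} \<Longrightarrow> \<bar>t - t'\<bar> \<le> C * \<bar>point t - point t'\<bar> powr s"
    using point_expanding[OF assms] by metis
  with assms(1) show ?thesis
    by (intro hausdorff_measure_nonzero_if_expanding[of point level C s]) (auto simp: point_level)
qed

text \<open>The measure is nonzero for positive \<open>s\<close> below \<open>g / \<alpha>\<close>
  and zero above; its value at \<open>g / \<alpha>\<close> itself does not affect the
  infimum.\<close>

lemma lyapunov_spectrum_eq: "lyapunov_spectrum n l r T \<alpha> = g / \<alpha>"
proof -
  define Z where "Z = {s. s > 0 \<and> hausdorff_measure s level = 0}"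
  have lower: "g / \<alpha> \<le> s" if "s \<in> Z" for s
    using that hausdorff_measure_level_nonzero[of s] exponent_pos
    by (force simp: Z_def field_simps not_le)
  have upper: "s \<in> Z" if "g / \<alpha> < s" for s
  proof -
    have "0 \<le> g / \<alpha>" using entropy_nonneg exponent_pos by simp
    with that have "0 < s" by linarith
    then show ?thesis
      using that hausdorff_measure_level_zero[of s] exponent_pos by (simp add: Z_def field_simps)
  qed
  have "Inf Z = g / \<alpha>"
  proof (rule antisym)
    show "g / \<alpha> \<le> Inf Z"
      using upper[of "g / \<alpha> + 1"] lower by (intro cInf_greatest) auto
    show "Inf Z \<le> g / \<alpha>"
    proof (rule dense_ge)
      fix s assume "g / \<alpha> < s"
      then show "Inf Z \<le> s"
        using upper lower by (intro cInf_lower) (auto intro!: bdd_belowI)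
    qed
  qed
  then show ?thesis
    by (simp add: lyapunov_spectrum_def hausdorff_dim_def Z_def level_def)
qed

end

section \<open>Maps with two slopes\<close>

text \<open>By monotonicity the values 0 and 1 are taken at the endpoints, so \<open>f a\<close>
  reveals the orientation.\<close>

lemma affine_onto_unit_interval:
  fixes f :: "real \<Rightarrow> real"
  assumes f: "\<And>x. f x = c * x + d" "f ` {a..b} = {0..1}" and ab: "a < b" and x: "x \<in> {a..b}"
  shows "x = (if f a = 0 then a + (b - a) * f x else b - (b - a) * f x)"
proof -
  have "0 \<in> f ` {a..b}" "1 \<in> f ` {a..b}"
    unfolding f(2) by simp_all
  then obtain x0 x1 where x01: "x0 \<in> {a..b}" "f x0 = 0" "x1 \<in> {a..b}" "f x1 = 1"
    by (elim imageE) simp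
  have ends: "f a \<in> {0..1}" "f b \<in> {0..1}"
    unfolding f(2)[symmetric] using ab by simp_all
  show ?thesis
  proof (cases "0 \<le> c")
    case True
    have "c * a \<le> c * x0" "c * x1 \<le> c * b"
      using True x01 by (auto intro!: mult_left_mono)
    then have "f a = 0" "f b = 1"
      using ends x01 f(1)[of a] f(1)[of b] f(1)[of x0] f(1)[of x1] by auto
    then have "c * a + d = 0" "c * b + d = 1"
      using f(1) by metis+
    then have "c * (b - a) = 1" "f x = c * (x - a)"
      using f(1)[of x] by (auto simp: algebra_simps)
    then have "(b - a) * f x = x - a"
      by (metis mult.assoc mult.commute mult_1)
    then show ?thesis using \<open>f a = 0\<close> by simp
  next
    case False
    have "c * x1 \<le> c * a" "c * b \<le> c * x0"
      using False x01 by (auto intro!: mult_left_mono_neg)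
    then have "f a = 1" "f b = 0"
      using ends x01 f(1)[of a] f(1)[of b] f(1)[of x0] f(1)[of x1] by auto
    then have "c * a + d = 1" "c * b + d = 0"
      using f(1) by metis+
    then have "c * (a - b) = 1" "f x = c * (x - b)"
      using f(1)[of x] by (auto simp: algebra_simps)
    then have "(a - b) * f x = x - b"
      by (metis mult.assoc mult.commute mult_1)
    then show ?thesis using \<open>f a = 1\<close> by (simp add: algebra_simps)
  qed
qed

lemma pl_expanding_map_branches:
  assumes "pl_expanding_map n l r T"
  obtains orient where "pl_branches n l r T orient"
proof -
  have bounds: "\<forall>i\<in>{1..n}. {l i..r i} \<subseteq> {0..1} \<and> 1 < pl_slope l r i"
    and disjoint: "disjoint_family_on (\<lambda>i. interior {l i..r i}) {1..n}"
    and "\<exists>f :: nat \<Rightarrow> real \<Rightarrow> real.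
        (\<forall>i\<in>{1..n}. (\<exists>c d. \<forall>x. f i x = c * x + d) \<and> f i ` {l i..r i} = {0..1}) \<and>
        (\<forall>x\<in>pl_domain n l r. \<exists>i\<in>{1..n}. x \<in> {l i..r i} \<and> T x = f i x)"
    using assms unfolding pl_expanding_map_def by - (elim conjE, assumption)+
  then obtain f :: "nat \<Rightarrow> real \<Rightarrow> real" where
    f: "\<forall>i\<in>{1..n}. (\<exists>c d. \<forall>x. f i x = c * x + d) \<and> f i ` {l i..r i} = {0..1}"
    and T: "\<forall>x\<in>pl_domain n l r. \<exists>i\<in>{1..n}. x \<in> {l i..r i} \<and> T x = f i x"
    by (elim exE conjE)
  have len: "l i < r i" if "i \<in> {1..n}" for i
  proof -
    \<comment> \<open>A slope above 1 excludes one-point intervals, where division by zero gives 0,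
      and empty ones, where the slope is negative.\<close>
    have s: "1 < 1 / (r i - l i)"
      using bspec[OF bounds that] by (simp add: pl_slope_def)
    then have "0 < 1 / (r i - l i)" by linarith
    then have "0 < r i - l i" by (simp only: zero_less_divide_1_iff)
    then show ?thesis by simp
  qed
  have "pl_branches n l r T (\<lambda>i. f i (l i) = 0)"
  proof unfold_locales
    fix i assume i: "i \<in> {1..n}"
    have "{l i..r i} \<subseteq> {0..1}"
      using bspec[OF bounds i] by simp
    then show "0 \<le> l i \<and> l i < r i \<and> r i \<le> 1"
      using len[OF i] by auto
  next
    fix i j x
    assume ij: "i \<in> {1..n}" "j \<in> {1..n}" and x: "x \<in> {l i<..<r i}" "x \<in> {l j<..<r j}"
    show "i = j"
    proof (rule ccontr)
      assume "i \<noteq> j"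
      then have "interior {l i..r i} \<inter> interior {l j..r j} = {}"
        by (rule disjoint_family_onD[OF disjoint ij])
      with x show False by auto
    qed
  next
    fix x assume "x \<in> pl_domain n l r"
    from bspec[OF T this] obtain i where i: "i \<in> {1..n}" "x \<in> {l i..r i}" "T x = f i x"
      by (elim bexE conjE)
    obtain c d where "\<And>x. f i x = c * x + d" and onto: "f i ` {l i..r i} = {0..1}"
      using bspec[OF f i(1)] by (elim conjE exE) simp
    then have "x = (if f i (l i) = 0 then l i + (r i - l i) * f i x else r i - (r i - l i) * f i x)"
      using affine_onto_unit_interval[of "f i" c d "l i" "r i" x] len[OF i(1)] i(2) by simp
    moreover have "f i x \<in> {0..1}"
      unfolding onto[symmetric] by (rule imageI[OF i(2)])
    ultimately have "T x \<in> {0..1} \<and> x =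
        (if f i (l i) = 0 then l i + (r i - l i) * T x else r i - (r i - l i) * T x)"
      unfolding i(3) by (intro conjI)
    then show "\<exists>i\<in>{1..n}. T x \<in> {0..1} \<and> x =
        (if f i (l i) = 0 then l i + (r i - l i) * T x else r i - (r i - l i) * T x)"
      by (rule bexI[OF _ i(1)])
  qed
  then show ?thesis by (rule that)
qed

lemma sum_two_values:
  fixes h :: "real \<Rightarrow> real"
  assumes "finite I" "\<And>i. i \<in> I \<Longrightarrow> s i \<in> {a, b}" "a \<noteq> b"
  shows "(\<Sum>i\<in>I. h (s i)) = card {i \<in> I. s i = a} * h a + card {i \<in> I. s i = b} * h b"
proof -
  have "(\<Sum>i\<in>I. h (s i)) = (\<Sum>i\<in>{i \<in> I. s i = a} \<union> {i \<in> I. s i = b}. h (s i))"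
    using assms(2) by (intro sum.cong) auto
  also have "\<dots> = (\<Sum>i\<in>{i \<in> I. s i = a}. h (s i)) + (\<Sum>i\<in>{i \<in> I. s i = b}. h (s i))"
    using assms by (intro sum.union_disjoint) auto
  finally show ?thesis by simp
qed

lemma lyapunov_spectrum_two_slopes:
  assumes "pl_branches n l r T orient"
    and slopes: "\<And>i. i \<in> {1..n} \<Longrightarrow> pl_slope l r i \<in> {a, b}"
    and ab: "1 < a" "a < b" and n: "2 \<le> n"
    and p: "p = card {i \<in> {1..n}. pl_slope l r i = a}" "0 < p"
    and q: "q = card {i \<in> {1..n}. pl_slope l r i = b}" "0 < q"
    and u: "u \<in> {ln a<..<ln b}"
  shows "lyapunov_spectrum n l r T u = two_slope_entropy (ln a) (ln b) p q u / u"
proof -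
  define D where "D = ln b - ln a"
  define \<theta> where "\<theta> = (u - ln a) / D"
  \<comment> \<open>\<open>E\<close> and \<open>E'\<close> are minus the logarithms of the
    probabilities of a single branch of slope \<open>b\<close> and of slope \<open>a\<close>. Then
    \<open>g + c * z\<close> is the affine function of \<open>z\<close> with value \<open>E\<close>
    at \<open>ln b - u\<close> and \<open>E'\<close> at \<open>ln a - u\<close>.\<close>
  define E where "E = ln q - ln \<theta>"
  define E' where "E' = ln p - ln (1 - \<theta>)"
  define g where "g = \<theta> * E + (1 - \<theta>) * E'"
  define c where "c = (E - E') / D"
  have D: "0 < D" using u by (simp add: D_def)
  have \<theta>: "0 < \<theta>" "\<theta> < 1" using u D by (auto simp: \<theta>_def D_def field_simps)
  have ua: "ln a - u = - \<theta> * D" and ub: "ln b - u = (1 - \<theta>) * D"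
    using D by (simp_all add: \<theta>_def D_def field_simps)
  have "g + c * (ln a - u) = E'" "g + c * (ln b - u) = E"
    using D unfolding ua ub g_def c_def by (simp_all add: field_simps)
  then have ea: "exp (- (g + c * (ln a - u))) = (1 - \<theta>) / p"
    and eb: "exp (- (g + c * (ln b - u))) = \<theta> / q"
    using \<theta> p q by (simp_all add: E_def E'_def exp_diff)
  have sum_eq: "(\<Sum>i=1..n. h (pl_slope l r i)) = real p * h a + real q * h b" for h :: "real \<Rightarrow> real"
    unfolding p(1) q(1) using slopes ab(2) by (intro sum_two_values) auto
  interpret pl_branches n l r T orient by fact
  interpret gibbs_weights n l r T orient u c g
  proof unfold_locales
    have "0 < ln a" using ab by (intro ln_gt_zero)
    with u show "0 < u" by (simp del: ln_gt_zero_iff)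
    show "(\<Sum>i=1..n. exp (- (g + c * (ln (pl_slope l r i) - u)))) = 1"
      unfolding sum_eq[of "\<lambda>x. exp (- (g + c * (ln x - u)))"] ea eb using p(2) q(2) by simp
    show "(\<Sum>i=1..n. exp (- (g + c * (ln (pl_slope l r i) - u))) * (ln (pl_slope l r i) - u)) = 0"
      unfolding sum_eq[of "\<lambda>x. exp (- (g + c * (ln x - u))) * (ln x - u)"] ea eb
      unfolding ua ub using p(2) q(2) by (simp add: field_simps)
  qed (use n in simp)
  show ?thesis
    using lyapunov_spectrum_eq
    by (simp add: two_slope_entropy_def g_def E_def E'_def \<theta>_def D_def Let_def)
qed

theorem theorem4p2:
  fixes n :: nat and l r :: "nat \<Rightarrow> real" and T :: "real \<Rightarrow> real"
  assumes "pl_expanding_map n l r T"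
    and "essential_branch_number n l r = 2"
  shows "finite (lyapunov_inflections n l r T) \<and> card (lyapunov_inflections n l r T) \<le> 2"
proof -
  let ?s = "pl_slope l r"
  define a b where "a = ?s 1" and "b = ?s n"
  obtain orient where branches: "pl_branches n l r T orient"
    using pl_expanding_map_branches[OF assms(1)] .
  have card2: "card (?s ` {1..n}) = 2"
    using assms(2) by (simp add: essential_branch_number_def)
  have n: "2 \<le> n"
    using card_image_le[of "{1..n}" ?s] card2 by simp
  have mono: "mono_on {1..n} ?s" and expanding: "1 < a"
    using assms(1) n unfolding pl_expanding_map_def a_def by auto
  have between: "a \<le> ?s i" "?s i \<le> b" if "i \<in> {1..n}" for i
    using that n unfolding a_def b_def by (auto intro!: mono_onD[OF mono])
  have ab: "a < b"
  proof (rule ccontr)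
    assume "\<not> a < b"
    then have "?s ` {1..n} \<subseteq> {a}" using between by force
    then have "card (?s ` {1..n}) \<le> card {a}" by (intro card_mono) auto
    with card2 show False by simp
  qed
  have "{a, b} = ?s ` {1..n}"
    using n ab card2 by (intro card_subset_eq) (auto simp: a_def b_def)
  then have slopes: "?s i \<in> {a, b}" if "i \<in> {1..n}" for i
    using that by blast
  define p q where "p = card {i \<in> {1..n}. ?s i = a}" and "q = card {i \<in> {1..n}. ?s i = b}"
  have "1 \<in> {i \<in> {1..n}. ?s i = a}" "n \<in> {i \<in> {1..n}. ?s i = b}"
    using n by (auto simp: a_def b_def)
  then have pq: "0 < p" "0 < q"
    unfolding p_def q_def by (auto simp: card_gt_0_iff)
  have "lyapunov_spectrum n l r T u = two_slope_entropy (ln a) (ln b) p q u / u"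
    if "u \<in> {ln a<..<ln b}" for u
    using lyapunov_spectrum_two_slopes[OF branches slopes expanding ab n p_def pq(1) q_def pq(2) that] .
  then show ?thesis
    using two_slope_inflections[of "ln a" "ln b" p q "lyapunov_spectrum n l r T"] expanding ab pq
    unfolding lyapunov_inflections_def a_def b_def by simp
qed

end
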